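(* Let $x,\zeta:[0,+\infty)\to\mathbb{R}$ be càdlàg functions and let $\varphi:(0,+\infty)\to[0,+\infty)$ be such that $\lim_{c\downarrow 0}\varphi(c)=0$. Then the following three conditions are equivalent: (i) for all $t\ge 0$, $\varphi(c)\,\mathrm{TV}^{c}(x,[0,t])\to\zeta_t$ as $c\downarrow 0$; (ii) for all $t\ge 0$, $2\varphi(c)\,\mathrm{UTV}^{c}(x,[0,t])\to\zeta_t$ as $c\downarrow 0$; (iii) for all $t\ge 0$, $2\varphi(c)\,\mathrm{DTV}^{c}(x,[0,t])\to\zeta_t$ as $c\downarrow 0$. Assume that any (equivalently, all) of these conditions holds. Then $\zeta$ is non-negative and non-decreasing, and for any continuous $g:\mathbb{R}\to\mathbb{R}$ and every $t\ge 0$, $$\varphi(c)\int_{\mathbb{R}}\mathrm{n}^{y,c}(x,[0,t])\,g(y)\,\mathrm{d}y\;\to\;\int_{(0,t]}g(x_{s-})\,\mathrm{d}\zeta_s\quad\text{as } c\downarrow 0,$$ where the right-hand side is a Lebesgue–Stieltjes integral. The same convergence also holds when $\mathrm{n}^{y,c}(x,[0,t])$ is replaced by $2\,\mathrm{u}^{y,c}(x,[0,t])$ or by $2\,\mathrm{d}^{y,c}(x,[0,t])$. Moreover, if $\zeta$ is continuous, then these convergences are uniform in $t$ on compact subsets of $[0,+\infty)$.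
   Context: Càdlàg means right-continuous on $[0,+\infty)$ with left limits on $(0,+\infty)$; $x_{s-}=\lim_{u<s,u\to s}x_u$ for $s>0$. Truncated variations: for $c\ge 0$ and $0\le s<t$, let $\Pi(s,t)$ be the family of all finite partitions of $[s,t]$ into subintervals $[u,v]$ with disjoint interiors and union $[s,t]$. With $(a)_+=\max(a,0)$, $$\mathrm{TV}^{c}(x,[s,t])=\sup_{\pi\in\Pi(s,t)}\sum_{[u,v]\in\pi}(|x_v-x_u|-c)_+,$$ $$\mathrm{UTV}^{c}(x,[s,t])=\sup_{\pi\in\Pi(s,t)}\sum_{[u,v]\in\pi}(x_v-x_u-c)_+,\qquad \mathrm{DTV}^{c}(x,[s,t])=\sup_{\pi\in\Pi(s,t)}\sum_{[u,v]\in\pi}(x_u-x_v-c)_+.$$ On the degenerate interval $[0,0]$ these are $0$. Numbers of interval crossings: for $y\in\mathbb{R}$, $c>0$, put $\sigma^c_0=s$ and for $n=0,1,2,\dots$ $$\rho^c_n=\inf\{u\in[\sigma^c_n,t]: x_u\ge y+c/2\},\qquad \sigma^c_{n+1}=\inf\{u\in[\rho^c_n,t]: x_u<y-c/2\},$$ with $\inf\emptyset=+\infty$ and $[+\infty,t]=\emptyset$. Then $\mathrm{d}^{y,c}(x,[s,t])=\max\{n:\sigma^c_n\le t\}$ (number of downcrossings of $[y-c/2,y+c/2]$), $\mathrm{u}^{y,c}(x,[s,t])=\mathrm{d}^{-y,c}(-x,[s,t])$ (number of upcrossings), and $\mathrm{n}^{y,c}(x,[s,t])=\mathrm{u}^{y,c}(x,[s,t])+\mathrm{d}^{y,c}(x,[s,t])$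 (number of crossings). *)

theory Defs
  imports "HOL-Analysis.Analysis"
begin

text \<open>
  Functions on \<open>[0,\<infinity>)\<close> are represented by total functions on \<^typ>\<open>real\<close>; nothing below depends on
  their values at negative arguments.
\<close>

definition cadlag :: "(real \<Rightarrow> real) \<Rightarrow> bool" where
  "cadlag x \<longleftrightarrow>
     (\<forall>t\<ge>0. continuous (at_right t) x) \<and> (\<forall>t>0. \<exists>l. (x \<longlongrightarrow> l) (at_left t))"

definition left_lim :: "(real \<Rightarrow> real) \<Rightarrow> real \<Rightarrow> real" where
  "left_lim x s = Lim (at_left s) x"

text \<open>
  A finite partition of \<open>[s,t]\<close> into subintervals with disjoint interiors is a division in the sense
  of \<^const>\<open>division_of\<close>; its element \<open>K = [u,v]\<close> has \<open>u = Inf K\<close> and \<open>v = Sup K\<close>.  Divisions may also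
  contain one-point intervals, but these contribute \<open>max (0 - c) 0 = 0\<close> to the sums for \<open>c \<ge> 0\<close>.
  In particular the degenerate interval \<open>[s,s]\<close> gets the value \<open>0\<close>.
\<close>

definition TV :: "real \<Rightarrow> (real \<Rightarrow> real) \<Rightarrow> real \<Rightarrow> real \<Rightarrow> ereal" where
  "TV c x s t =
     (SUP \<pi>\<in>{\<pi>. \<pi> division_of {s..t}}. ereal (\<Sum>K\<in>\<pi>. max (\<bar>x (Sup K) - x (Inf K)\<bar> - c) 0))"

definition UTV :: "real \<Rightarrow> (real \<Rightarrow> real) \<Rightarrow> real \<Rightarrow> real \<Rightarrow> ereal" where
  "UTV c x s t =
     (SUP \<pi>\<in>{\<pi>. \<pi> division_of {s..t}}. ereal (\<Sum>K\<in>\<pi>. max (x (Sup K) - x (Inf K) - c) 0))"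

definition DTV :: "real \<Rightarrow> (real \<Rightarrow> real) \<Rightarrow> real \<Rightarrow> real \<Rightarrow> ereal" where
  "DTV c x s t =
     (SUP \<pi>\<in>{\<pi>. \<pi> division_of {s..t}}. ereal (\<Sum>K\<in>\<pi>. max (x (Inf K) - x (Sup K) - c) 0))"

text \<open>
  Crossing times are extended reals: the infimum of the empty set is \<open>\<infinity>\<close>, and no real \<open>u\<close> satisfies
  \<open>\<infinity> \<le> ereal u\<close>, so a crossing time after \<open>\<infinity>\<close> is again \<open>\<infinity>\<close>.
\<close>

definition up_time :: "real \<Rightarrow> real \<Rightarrow> (real \<Rightarrow> real) \<Rightarrow> real \<Rightarrow> ereal \<Rightarrow> ereal" where
  "up_time y c x t \<sigma> = Inf (ereal ` {u. \<sigma> \<le> ereal u \<and> u \<le> t \<and> x u \<ge> y + c / 2})"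

definition down_time :: "real \<Rightarrow> real \<Rightarrow> (real \<Rightarrow> real) \<Rightarrow> real \<Rightarrow> ereal \<Rightarrow> ereal" where
  "down_time y c x t \<rho> = Inf (ereal ` {u. \<rho> \<le> ereal u \<and> u \<le> t \<and> x u < y - c / 2})"

primrec sigma :: "real \<Rightarrow> real \<Rightarrow> (real \<Rightarrow> real) \<Rightarrow> real \<Rightarrow> real \<Rightarrow> nat \<Rightarrow> ereal" where
  "sigma y c x s t 0 = ereal s"
| "sigma y c x s t (Suc n) = down_time y c x t (up_time y c x t (sigma y c x s t n))"

definition dcross :: "real \<Rightarrow> real \<Rightarrow> (real \<Rightarrow> real) \<Rightarrow> real \<Rightarrow> real \<Rightarrow> nat" where
  "dcross y c x s t = Max {n. sigma y c x s t n \<le> ereal t}"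

definition ucross :: "real \<Rightarrow> real \<Rightarrow> (real \<Rightarrow> real) \<Rightarrow> real \<Rightarrow> real \<Rightarrow> nat" where
  "ucross y c x s t = dcross (- y) c (\<lambda>u. - x u) s t"

definition ncross :: "real \<Rightarrow> real \<Rightarrow> (real \<Rightarrow> real) \<Rightarrow> real \<Rightarrow> real \<Rightarrow> nat" where
  "ncross y c x s t = ucross y c x s t + dcross y c x s t"

text \<open>
  Lebesgue-Stieltjes integral of \<open>f\<close> over \<open>(0,t]\<close> with respect to a non-decreasing right-continuous
  \<open>\<zeta>\<close> on \<open>[0,\<infinity>)\<close>.  As \<^const>\<open>interval_measure\<close> expects a function on the whole line, \<open>\<zeta>\<close> is extended
  by \<open>\<zeta> 0\<close> to the left of \<open>0\<close>; this does not affect the measure on \<open>(0,\<infinity>)\<close>.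
\<close>

definition LS_integral :: "(real \<Rightarrow> real) \<Rightarrow> (real \<Rightarrow> real) \<Rightarrow> real \<Rightarrow> real" where
  "LS_integral f \<zeta> t = (LINT s:{0<..t}|interval_measure (\<lambda>s. \<zeta> (max 0 s)). f s)"

definition TV_conv :: "(real \<Rightarrow> real) \<Rightarrow> (real \<Rightarrow> real) \<Rightarrow> (real \<Rightarrow> real) \<Rightarrow> bool" where
  "TV_conv \<phi> x \<zeta> \<longleftrightarrow>
     (\<forall>t\<ge>0. ((\<lambda>c. ereal (\<phi> c) * TV c x 0 t) \<longlongrightarrow> ereal (\<zeta> t)) (at_right 0))"

definition UTV_conv :: "(real \<Rightarrow> real) \<Rightarrow> (real \<Rightarrow> real) \<Rightarrow> (real \<Rightarrow> real) \<Rightarrow> bool" where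
  "UTV_conv \<phi> x \<zeta> \<longleftrightarrow>
     (\<forall>t\<ge>0. ((\<lambda>c. ereal (2 * \<phi> c) * UTV c x 0 t) \<longlongrightarrow> ereal (\<zeta> t)) (at_right 0))"

definition DTV_conv :: "(real \<Rightarrow> real) \<Rightarrow> (real \<Rightarrow> real) \<Rightarrow> (real \<Rightarrow> real) \<Rightarrow> bool" where
  "DTV_conv \<phi> x \<zeta> \<longleftrightarrow>
     (\<forall>t\<ge>0. ((\<lambda>c. ereal (2 * \<phi> c) * DTV c x 0 t) \<longlongrightarrow> ereal (\<zeta> t)) (at_right 0))"

end

theory Submission
  imports Defs
begin

text \<open>
  Write \<open>T\<^sub>t\<close> for the truncated variation on \<open>[0,t]\<close> at level \<open>c\<close>.  It is superadditive:
  \<open>T\<^sub>t \<ge> T\<^sub>s + (\<bar>x\<^sub>t - x\<^sub>s\<bar> - c)\<^sub>+\<close>.  Hence the non-decreasing functions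
  \<open>P\<^sub>t = sup (T\<^sub>s - x\<^sub>s)\<close> and \<open>Q\<^sub>t = sup (T\<^sub>s + x\<^sub>s)\<close> (over \<open>s \<le> t\<close>) exceed \<open>T\<^sub>t \<mp> x\<^sub>t\<close> by at most
  \<open>c\<close>, so \<open>z = (Q - P) / 2\<close> stays within \<open>c / 2\<close> of \<open>x\<close>, and it drops by at most half of the
  increments of \<open>P\<close>.  A downcrossing of \<open>[y - c/2, y + c/2]\<close> by \<open>x\<close> makes \<open>z\<close> cross the level \<open>y\<close>, and
  integrating over \<open>y\<close> bounds twice the integral of the downcrossing numbers by \<open>T\<^sub>t + O(1)\<close>, uniformly
  in \<open>c\<close>.  Conversely, counting the intervals of a partition which straddle \<open>y\<close> shows that the
  integrals of the up- and downcrossing numbers dominate UTV and DTV, whose sum dominates TV.  So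
  TV, 2 UTV, 2 DTV and the integrals of \<open>n\<close>, \<open>2u\<close>, \<open>2d\<close> agree up to \<open>O(1)\<close>, which \<open>\<phi>\<close> kills.

  For the weighted integrals, cut \<open>[0,t]\<close> into finitely many intervals \<open>[\<tau>\<^sub>i, \<tau>\<^sub>i\<^sub>+\<^sub>1)\<close> on which \<open>x\<close> oscillates
  by at most \<open>\<epsilon>\<close>.  At levels farther than \<open>\<epsilon>\<close> from \<open>x(\<tau>\<^sub>i)\<close>, the number of crossings increases by at
  most a constant over the \<open>i\<close>-th interval, so \<open>g(y)\<close> may be replaced by \<open>g(x(\<tau>\<^sub>i))\<close> there, and the
  resulting sums are Riemann-Stieltjes sums of \<open>g(x\<^sub>s\<^sub>-) d\<zeta>\<^sub>s\<close>.
\<close>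

section \<open>Downcrossings as alternating sequences\<close>

text \<open>Unlike \<^const>\<open>sigma\<close>, this predicate is monotone in the two levels \<open>p\<close> and \<open>q\<close> separately.\<close>

primrec downs :: "(real \<Rightarrow> real) \<Rightarrow> real \<Rightarrow> real \<Rightarrow> nat \<Rightarrow> real \<Rightarrow> bool" where
  "downs x p q 0 t \<longleftrightarrow> True"
| "downs x p q (Suc n) t \<longleftrightarrow>
     (\<exists>a b. 0 \<le> a \<and> a < b \<and> b \<le> t \<and> p \<le> x a \<and> x b < q \<and> downs x p q n a)"

lemma downs_SucI:
  "0 \<le> a \<Longrightarrow> a < b \<Longrightarrow> b \<le> t \<Longrightarrow> p \<le> x a \<Longrightarrow> x b < q \<Longrightarrow> downs x p q n a \<Longrightarrow> downs x p q (Suc n) t"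
  by auto

lemma downs_mono_time: "downs x p q n s \<Longrightarrow> s \<le> t \<Longrightarrow> downs x p q n t"
  by (cases n) (auto intro: order_trans)

lemma downs_Suc: "downs x p q (Suc n) t \<Longrightarrow> downs x p q n t"
  by (auto intro: downs_mono_time)

lemma downs_le:
  assumes "m \<le> n" "downs x p q n t"
  shows "downs x p q m t"
  using assms
proof (induction n rule: dec_induct)
  case (step k)
  then show ?case using downs_Suc by blast
qed

lemma downs_mono_levels: "downs x p q n t \<Longrightarrow> p' \<le> p \<Longrightarrow> q \<le> q' \<Longrightarrow> downs x p' q' n t"
proof (induction n arbitrary: t)
  case (Suc n)
  then obtain a b where "0 \<le> a" "a < b" "b \<le> t" "p \<le> x a" "x b < q" "downs x p q n a" by auto
  then show ?case using Suc.IH[of a] Suc.prems by (intro downs_SucI[of a b]) auto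
qed simp

text \<open>Only finitely many strict inequalities \<open>x b < q\<close> occur, so there is room
  between the largest of these values and \<open>q\<close>. This room later allows a rational lower
  level in the measurability proof.\<close>

lemma downs_lower_level: "downs x p q n t \<Longrightarrow> \<exists>q'<q. downs x p q' n t"
proof (induction n arbitrary: t)
  case 0
  show ?case by (auto intro: lt_ex)
next
  case (Suc n)
  then obtain a b where ab: "0 \<le> a" "a < b" "b \<le> t" "p \<le> x a" "x b < q" "downs x p q n a" by auto
  with Suc.IH obtain q' where q': "q' < q" "downs x p q' n a" by blast
  obtain r where r: "max q' (x b) < r" "r < q" using dense[of "max q' (x b)" q] q' ab by auto
  have "downs x p r n a" using downs_mono_levels[OF q'(2), of p r] r by auto
  then have "downs x p r (Suc n) t" using ab r by auto
  then show ?case using r by blast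
qed

text \<open>Right-continuity turns the infimum into a minimum: if \<open>x\<close> were below the
  threshold at the infimum, it would stay below on a short interval to the right, which would then
  contain no point of the set.\<close>

lemma up_time_attained:
  fixes x :: "real \<Rightarrow> real"
  assumes x: "cadlag x" and "0 \<le> r" and ne: "up_time y c x t (ereal r) \<noteq> \<infinity>"
  obtains u where "up_time y c x t (ereal r) = ereal u" "r \<le> u" "u \<le> t" "y + c / 2 \<le> x u"
proof -
  define S where "S = {u. r \<le> u \<and> u \<le> t \<and> y + c / 2 \<le> x u}"
  have eq: "up_time y c x t (ereal r) = Inf (ereal ` S)"
    by (simp add: up_time_def S_def)
  have S: "S \<noteq> {}" using ne eq by (auto simp: top_ereal_def)
  have bdd: "bdd_below S" by (auto simp: S_def intro: bdd_belowI)
  define u where "u = Inf S"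
  have ge: "r \<le> u" unfolding u_def using S by (auto intro: cInf_greatest simp: S_def)
  have le: "u \<le> t"
  proof -
    obtain v where "v \<in> S" using S by auto
    then show ?thesis using cInf_lower[OF _ bdd, of v] by (auto simp: u_def S_def)
  qed
  have "y + c / 2 \<le> x u"
  proof (rule ccontr)
    assume neg: "\<not> y + c / 2 \<le> x u"
    moreover have "(x \<longlongrightarrow> x u) (at_right u)"
      using x ge \<open>0 \<le> r\<close> by (auto simp: cadlag_def continuous_within)
    ultimately have "\<forall>\<^sub>F v in at_right u. x v < y + c / 2"
      by (auto intro: order_tendstoD)
    then obtain b where b: "b > u" "\<And>v. u < v \<Longrightarrow> v < b \<Longrightarrow> x v < y + c / 2"
      by (auto simp: eventually_at_right[of u "u + 1"])
    obtain v where "v \<in> S" "v < b" using cInf_lessD[OF S, of b] b by (auto simp: u_def)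
    moreover have "u \<le> v" using \<open>v \<in> S\<close> bdd by (auto simp: u_def intro: cInf_lower)
    ultimately show False using b(2)[of v] neg by (cases "v = u") (auto simp: S_def)
  qed
  moreover have "Inf (ereal ` S) = ereal u"
    using ereal_Inf'[OF bdd S] by (simp add: u_def)
  ultimately show thesis using that eq ge le by auto
qed

text \<open>The greedy crossing times never lag behind another alternating sequence: each
  \<open>a\<close> and each \<open>b\<close> is a candidate in the infimum that defines the
  corresponding time.\<close>

lemma sigma_le_of_downs:
  "downs x (y + c / 2) (y - c / 2) n v \<Longrightarrow> 0 \<le> v \<Longrightarrow> v \<le> t \<Longrightarrow> sigma y c x 0 t n \<le> ereal v"
proof (induction n arbitrary: v)
  case (Suc n)
  then obtain a b where ab: "0 \<le> a" "a < b" "b \<le> v" "y + c / 2 \<le> x a" "x b < y - c / 2"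
    "downs x (y + c / 2) (y - c / 2) n a" by auto
  have "sigma y c x 0 t n \<le> ereal a" using Suc ab by auto
  then have "up_time y c x t (sigma y c x 0 t n) \<le> ereal a"
    using ab Suc.prems by (auto simp: up_time_def intro!: Inf_lower)
  then have "up_time y c x t (sigma y c x 0 t n) \<le> ereal b"
    using ab by (meson ereal_less_eq(3) less_imp_le order_trans)
  then have "sigma y c x 0 t (Suc n) \<le> ereal b"
    using ab Suc.prems by (auto simp: down_time_def intro!: Inf_lower)
  then show ?case using ab by (meson ereal_less_eq(3) order_trans)
qed simp

text \<open>The condition \<open>x v < y - c / 2\<close> is strict, so the infimum \<open>r\<close>
  defining \<open>sigma\<close> need not be attained, and the induction has to carry more than the
  claim at \<open>t\<close>: the \<open>n\<close> downcrossings are complete at every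
  \<open>v > r\<close>, and at \<open>r\<close> itself unless \<open>x r\<close> is below the upper
  level. At the next upward time \<open>x\<close> has reached the upper level, so in both cases they
  are complete there.\<close>

lemma downs_of_sigma_le:
  assumes x: "cadlag x" and c: "c > 0" and t: "0 \<le> t"
  shows "sigma y c x 0 t n \<le> ereal t \<Longrightarrow>
    \<exists>r. sigma y c x 0 t n = ereal r \<and> 0 \<le> r \<and> downs x (y + c / 2) (y - c / 2) n t \<and>
      (\<forall>v>r. downs x (y + c / 2) (y - c / 2) n v) \<and>
      (downs x (y + c / 2) (y - c / 2) n r \<or> x r < y + c / 2)"
proof (induction n)
  case (Suc n)
  let ?p = "y + c / 2" and ?q = "y - c / 2"
  let ?\<rho> = "up_time y c x t (sigma y c x 0 t n)"
  have fin: "?\<rho> \<noteq> \<infinity>"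
    using Suc.prems by (auto simp: down_time_def top_ereal_def)
  have "sigma y c x 0 t n \<le> ereal t"
  proof (rule ccontr)
    assume "\<not> ?thesis"
    then have "\<And>u. \<not> (sigma y c x 0 t n \<le> ereal u \<and> u \<le> t)"
      by (meson ereal_less_eq(3) order_trans)
    then have "{u. sigma y c x 0 t n \<le> ereal u \<and> u \<le> t \<and> y + c / 2 \<le> x u} = {}" by blast
    then have "?\<rho> = \<infinity>" by (simp only: up_time_def image_empty Inf_empty top_ereal_def)
    then show False using fin by simp
  qed
  from Suc.IH[OF this] obtain r where r: "sigma y c x 0 t n = ereal r" "0 \<le> r"
     "\<And>v. v > r \<Longrightarrow> downs x ?p ?q n v" "downs x ?p ?q n r \<or> x r < ?p" by blast
  obtain u where u: "?\<rho> = ereal u" "r \<le> u" "u \<le> t" "?p \<le> x u"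
    using up_time_attained[OF x r(2)] fin r(1) by metis
  have dn: "downs x ?p ?q n u" using r u by (cases "u = r") auto
  define S where "S = {v. u \<le> v \<and> v \<le> t \<and> x v < ?q}"
  have eq: "sigma y c x 0 t (Suc n) = Inf (ereal ` S)"
    by (simp add: u down_time_def S_def)
  have S: "S \<noteq> {}" using Suc.prems unfolding eq by (auto simp: top_ereal_def)
  have bdd: "bdd_below S" by (auto simp: S_def intro: bdd_belowI)
  define r' where "r' = Inf S"
  have eq': "sigma y c x 0 t (Suc n) = ereal r'"
    using ereal_Inf'[OF bdd S] unfolding eq r'_def by simp
  have ge: "u \<le> r'" unfolding r'_def using S by (auto intro: cInf_greatest simp: S_def)
  have dS: "downs x ?p ?q (Suc n) w" if "v \<in> S" "v \<le> w" for v w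
  proof -
    have "u < v" using that u c by (cases "u = v") (auto simp: S_def)
    then show ?thesis using that u r dn by (intro downs_SucI[of u v]) (auto simp: S_def)
  qed
  have a1: "downs x ?p ?q (Suc n) t" using S dS by (auto simp: S_def)
  have a2: "downs x ?p ?q (Suc n) v" if v: "v > r'" for v
    using cInf_lessD[OF S, of v] v dS[of _ v] by (auto simp: r'_def simp del: downs.simps)
  have a3: "downs x ?p ?q (Suc n) r' \<or> x r' < ?p"
  proof (cases "r' \<in> S")
    case True
    then show ?thesis using dS by blast
  next
    case False
    \<comment> \<open>A value of at least \<open>?p\<close> at \<open>r'\<close> exceeds
      \<open>?q\<close> and by right-continuity would keep \<open>x\<close> above \<open>?q\<close>
      just after \<open>r'\<close>, where an unattained infimum must have points of
      \<open>S\<close>.\<close>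
    have "\<not> ?p \<le> x r'"
    proof
      assume p: "?p \<le> x r'"
      then have "?q < x r'" using c by auto
      moreover have "(x \<longlongrightarrow> x r') (at_right r')"
        using x ge u(2) r(2) by (auto simp: cadlag_def continuous_within)
      ultimately have "\<forall>\<^sub>F v in at_right r'. x v > ?q"
        by (auto intro: order_tendstoD)
      then obtain b where b: "b > r'" "\<And>v. r' < v \<Longrightarrow> v < b \<Longrightarrow> x v > ?q"
        by (auto simp: eventually_at_right[of r' "r' + 1"])
      obtain v where "v \<in> S" "v < b" using cInf_lessD[OF S, of b] b by (auto simp: r'_def)
      moreover have "r' \<le> v" using \<open>v \<in> S\<close> bdd by (auto simp: r'_def intro: cInf_lower)
      ultimately show False using b(2)[of v] False by (cases "v = r'") (auto simp: S_def)
    qed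
    then show ?thesis by auto
  qed
  show ?case using eq' a1 a2 a3 ge u(2) r(2) by (auto simp del: downs.simps sigma.simps)
qed (use t in auto)

lemma sigma_le_iff_downs:
  assumes "cadlag x" "c > 0" "0 \<le> t"
  shows "sigma y c x 0 t n \<le> ereal t \<longleftrightarrow> downs x (y + c / 2) (y - c / 2) n t"
  using downs_of_sigma_le[OF assms] sigma_le_of_downs[of x y c n t t] assms by blast

section \<open>Paths with small oscillation between finitely many times\<close>

text \<open>Bolzano's bisection principle reduces the claim to a neighbourhood of a single time
  \<open>s\<close>, where \<open>{s}\<close> suffices as exceptional set: just before
  \<open>s\<close> the values are within \<open>e / 2\<close> of the left limit, and from
  \<open>s\<close> on within \<open>e / 2\<close> of \<open>x s\<close>. The interval
  \<open>{u<..v}\<close> is open at \<open>u\<close> because a jump at time \<open>u\<close> is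
  already contained in \<open>x u\<close>.\<close>

lemma finite_oscillation_set:
  assumes x: "cadlag x" and T: "0 \<le> T" and e: "e > 0"
  obtains F where "finite F" "\<And>u v. 0 \<le> u \<Longrightarrow> u \<le> v \<Longrightarrow> v \<le> T \<Longrightarrow> F \<inter> {u<..v} = {} \<Longrightarrow> \<bar>x u - x v\<bar> \<le> e"
proof -
  define P where "P a b \<longleftrightarrow> (\<exists>F. finite F \<and>
    (\<forall>u v. 0 \<le> u \<and> a \<le> u \<and> u \<le> v \<and> v \<le> b \<and> F \<inter> {u<..v} = {} \<longrightarrow> \<bar>x u - x v\<bar> \<le> e))" for a b
  have "P 0 T"
  proof (rule Bolzano[OF T])
    fix a b c assume "P a b" "P b c" "a \<le> b" "b \<le> c"
    from \<open>P a b\<close> obtain F where F: "finite F"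
      "\<forall>u v. 0 \<le> u \<and> a \<le> u \<and> u \<le> v \<and> v \<le> b \<and> F \<inter> {u<..v} = {} \<longrightarrow> \<bar>x u - x v\<bar> \<le> e"
      unfolding P_def by blast
    from \<open>P b c\<close> obtain G where G: "finite G"
      "\<forall>u v. 0 \<le> u \<and> b \<le> u \<and> u \<le> v \<and> v \<le> c \<and> G \<inter> {u<..v} = {} \<longrightarrow> \<bar>x u - x v\<bar> \<le> e"
      unfolding P_def by blast
    show "P a c" unfolding P_def
    \<comment> \<open>The junction \<open>b\<close> is declared exceptional as well, so an
      admissible pair \<open>u\<close>, \<open>v\<close> lies entirely on one side of it.\<close>
    proof (intro exI[of _ "insert b (F \<union> G)"] conjI allI impI)
      fix u v assume uv: "0 \<le> u \<and> a \<le> u \<and> u \<le> v \<and> v \<le> c \<and> insert b (F \<union> G) \<inter> {u<..v} = {}"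
      then have "v < b \<or> b \<le> u" by auto
      then show "\<bar>x u - x v\<bar> \<le> e" using F(2) G(2) uv by (auto simp: Int_Un_distrib2)
    qed (use F G in auto)
  next
    fix s assume s: "0 \<le> s" "s \<le> T"
    have "(x \<longlongrightarrow> x s) (at_right s)" using x s by (auto simp: cadlag_def continuous_within)
    then have "\<forall>\<^sub>F v in at_right s. \<bar>x v - x s\<bar> < e / 2"
      using tendstoD[of x "x s" _ "e / 2"] e by (simp add: dist_real_def)
    then obtain b where b: "b > s" "\<And>v. s < v \<Longrightarrow> v < b \<Longrightarrow> \<bar>x v - x s\<bar> < e / 2"
      by (auto simp: eventually_at_right[of s "s + 1"])
    have "\<exists>a l. a < s \<and> (\<forall>v. 0 \<le> v \<longrightarrow> a < v \<longrightarrow> v < s \<longrightarrow> \<bar>x v - l\<bar> < e / 2)"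
    \<comment> \<open>At \<open>s = 0\<close> there is no left limit, but also no \<open>v\<close>
      with \<open>0 \<le> v\<close> and \<open>v < s\<close>, so the claim is vacuous for any
      negative \<open>a\<close>.\<close>
    proof (cases "s = 0")
      case False
      then obtain l where "(x \<longlongrightarrow> l) (at_left s)"
        using x s unfolding cadlag_def by (metis order_le_less)
      then have "\<forall>\<^sub>F v in at_left s. \<bar>x v - l\<bar> < e / 2"
        using tendstoD[of x l _ "e / 2"] e by (simp add: dist_real_def)
      then show ?thesis by (auto simp: eventually_at_left[of "s - 1" s])
    qed (auto intro: exI[of _ "-1"])
    then obtain a l where a: "a < s" "\<And>v. 0 \<le> v \<Longrightarrow> a < v \<Longrightarrow> v < s \<Longrightarrow> \<bar>x v - l\<bar> < e / 2" by blast
    show "\<exists>d>0. \<forall>a b. a \<le> s \<and> s \<le> b \<and> b - a < d \<longrightarrow> P a b"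
    proof (intro exI[of _ "min (b - s) (s - a)"] conjI allI impI)
      fix a' b' assume ab: "a' \<le> s \<and> s \<le> b' \<and> b' - a' < min (b - s) (s - a)"
      show "P a' b'" unfolding P_def
      proof (intro exI[of _ "{s}"] conjI allI impI)
        fix u v assume uv: "0 \<le> u \<and> a' \<le> u \<and> u \<le> v \<and> v \<le> b' \<and> {s} \<inter> {u<..v} = {}"
        then consider "v < s" | "s \<le> u" by force
        then show "\<bar>x u - x v\<bar> \<le> e"
        proof cases
          case 1
          then have "\<bar>x u - l\<bar> < e / 2" "\<bar>x v - l\<bar> < e / 2" using a(2)[of u] a(2)[of v] uv ab by auto
          then show ?thesis by linarith
        next
          case 2
          have "\<bar>x w - x s\<bar> < e / 2" if "s \<le> w" "w \<le> b'" for w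
            using b(2)[of w] that ab e by (cases "w = s") auto
          from this[of u] this[of v] have "\<bar>x u - x s\<bar> < e / 2" "\<bar>x v - x s\<bar> < e / 2" using uv 2 by auto
          then show ?thesis by linarith
        qed
      qed auto
    qed (use a b in auto)
  qed
  then show thesis using that unfolding P_def by auto
qed

text \<open>The times are the exceptional set together with \<open>0\<close> and \<open>T\<close>,
  listed in increasing order; no exceptional time lies strictly between two neighbours.\<close>

lemma cadlag_partition:
  assumes x: "cadlag x" and T: "0 \<le> T" and e: "e > 0"
  obtains \<tau> :: "nat \<Rightarrow> real" and m where "\<tau> 0 = 0" "\<tau> m = T" "\<And>i j. i < j \<Longrightarrow> j \<le> m \<Longrightarrow> \<tau> i < \<tau> j"
    "\<And>i u v. i < m \<Longrightarrow> u \<in> {\<tau> i..<\<tau> (Suc i)} \<Longrightarrow> v \<in> {\<tau> i..<\<tau> (Suc i)} \<Longrightarrow> \<bar>x u - x v\<bar> \<le> e"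
proof -
  obtain F where F: "finite F" "\<And>u v. 0 \<le> u \<Longrightarrow> u \<le> v \<Longrightarrow> v \<le> T \<Longrightarrow> F \<inter> {u<..v} = {} \<Longrightarrow> \<bar>x u - x v\<bar> \<le> e"
    using finite_oscillation_set[OF assms] by metis
  define G where "G = insert 0 (insert T (F \<inter> {0..T}))"
  have G: "finite G" "G \<subseteq> {0..T}" "0 \<in> G" "T \<in> G" using F T by (auto simp: G_def)
  define L where "L = sorted_list_of_set G"
  have L: "set L = G" "sorted_wrt (<) L" using G by (auto simp: L_def)
  have mono: "L ! i < L ! j" if "i < j" "j < length L" for i j
    using sorted_wrt_nth_less[OF L(2) that] .
  have len: "length L > 0" using L G by auto
  have in_G: "L ! i \<in> G" if "i < length L" for i using that L(1) by auto
  have first: "L ! 0 = 0"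
  proof -
    obtain i where i: "i < length L" "L ! i = 0" using G L(1) by (metis in_set_conv_nth)
    show ?thesis using mono[of 0 i] i in_G[of 0] G len by (cases "i = 0") auto
  qed
  have last: "L ! (length L - 1) = T"
  proof -
    obtain i where i: "i < length L" "L ! i = T" using G L(1) by (metis in_set_conv_nth)
    show ?thesis using mono[of i "length L - 1"] i in_G[of "length L - 1"] G len
      by (cases i "length L - 1" rule: linorder_cases) auto
  qed
  have osc: "\<bar>x u - x v\<bar> \<le> e" if i: "i < length L - 1"
    and uv: "u \<in> {L ! i..<L ! Suc i}" "v \<in> {L ! i..<L ! Suc i}" "u \<le> v" for i u v
  proof (rule F(2))
    have i': "i < length L" "Suc i < length L" using i by auto
    have "L ! i \<in> G" "L ! Suc i \<in> G" using i in_G by auto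
    then have "0 \<le> L ! i" "L ! Suc i \<le> T" using G by auto
    then show "0 \<le> u" "v \<le> T" using uv by auto
    show "u \<le> v" by fact
    show "F \<inter> {u<..v} = {}"
    proof (rule ccontr)
      assume "F \<inter> {u<..v} \<noteq> {}"
      then obtain f where f: "f \<in> F" "u < f" "f \<le> v" by auto
      then have "f \<in> G" using \<open>0 \<le> u\<close> \<open>v \<le> T\<close> by (auto simp: G_def)
      then obtain k where k: "k < length L" "L ! k = f" using L(1) by (metis in_set_conv_nth)
      have "i < k" using mono[of k i] k f uv i' by (cases k i rule: linorder_cases) auto
      moreover have "k < Suc i" using mono[of "Suc i" k] k f uv i' by (cases k "Suc i" rule: linorder_cases) auto
      ultimately show False by auto
    qed
  qed
  show thesis
  proof (rule that[of "\<lambda>i. L ! i" "length L - 1"])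
    fix i u v assume a: "i < length L - 1" "u \<in> {L ! i..<L ! Suc i}" "v \<in> {L ! i..<L ! Suc i}"
    then show "\<bar>x u - x v\<bar> \<le> e" using osc[of i u v] osc[of i v u] by (cases "u \<le> v") auto
  qed (use first last mono len in auto)
qed

lemma cadlag_uminus: "cadlag x \<Longrightarrow> cadlag (\<lambda>u. - x u)"
  unfolding cadlag_def by (blast intro: continuous_minus tendsto_minus)

section \<open>Downcrossings counted along finitely many samples\<close>

lemma exists_downward_step:
  fixes W :: "nat \<Rightarrow> real"
  assumes "i \<le> k" "y \<le> W i" "W k < y"
  obtains j where "i \<le> j" "j < k" "y \<le> W j" "W (Suc j) < y"
proof -
  have "\<exists>j\<ge>i. j < k \<and> y \<le> W j \<and> W (Suc j) < y"
    using assms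
  proof (induction k rule: dec_induct)
    case (step k)
    show ?case
    proof (cases "W k < y")
      case True
      then show ?thesis using step by (meson less_SucI)
    qed (use step in \<open>auto intro!: exI[of _ k]\<close>)
  qed simp
  then show thesis using that by blast
qed

text \<open>For \<open>i = m\<close> there is no upper bound on \<open>s\<close>. Thus the end time
  \<open>\<tau> m\<close>, which belongs to none of the half-open intervals, has an index
  too.\<close>

definition step_index :: "(nat \<Rightarrow> real) \<Rightarrow> nat \<Rightarrow> nat \<Rightarrow> real \<Rightarrow> bool" where
  "step_index \<tau> m i s \<longleftrightarrow> i \<le> m \<and> \<tau> i \<le> s \<and> (i < m \<longrightarrow> s < \<tau> (Suc i))"

text \<open>The sequence \<open>W\<close> is a discrete substitute for the path. The indices of the
  two ends \<open>a\<close> and \<open>b\<close> of a downcrossing carry values of \<open>W\<close>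
  on opposite sides of \<open>y\<close>, so \<open>W\<close> steps down through \<open>y\<close>
  between them. These steps are distinct, because the steps counted for earlier downcrossings have
  indices below that of \<open>a\<close>. It is applied to samples of \<open>x\<close> itself and to
  samples of the auxiliary path \<open>z\<close>.\<close>

lemma downs_le_downward_steps:
  fixes \<tau> W :: "nat \<Rightarrow> real"
  assumes \<tau>: "\<tau> 0 = 0" "\<And>i j. i < j \<Longrightarrow> j \<le> m \<Longrightarrow> \<tau> i < \<tau> j"
    and W: "\<And>i s. step_index \<tau> m i s \<Longrightarrow> s \<le> T \<Longrightarrow> p \<le> x s \<Longrightarrow> y \<le> W i" "\<And>i s. step_index \<tau> m i s \<Longrightarrow> s \<le> T \<Longrightarrow> x s < q \<Longrightarrow> W i < y"
  shows "downs x p q n v \<Longrightarrow> v \<le> T \<Longrightarrow> step_index \<tau> m i v \<Longrightarrow> n \<le> card {j. j < i \<and> y \<le> W j \<and> W (Suc j) < y}"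
proof (induction n arbitrary: v i)
  case (Suc n)
  have I_ex: "\<exists>i. step_index \<tau> m i s" if "0 \<le> s" for s
  proof -
    define i where "i = Max {i. i \<le> m \<and> \<tau> i \<le> s}"
    have fin: "finite {i. i \<le> m \<and> \<tau> i \<le> s}" by (rule finite_subset[of _ "{..m}"]) auto
    have "i \<in> {i. i \<le> m \<and> \<tau> i \<le> s}" unfolding i_def using fin \<tau>(1) that by (intro Max_in) auto
    moreover have "\<not> \<tau> (Suc i) \<le> s" if "i < m"
    proof
      assume "\<tau> (Suc i) \<le> s"
      then have "Suc i \<le> i" unfolding i_def using fin that by (intro Max_ge) (auto simp: i_def)
      then show False by simp
    qed
    ultimately show ?thesis by (auto simp: step_index_def)
  qed
  have I_mono: "i \<le> k" if "step_index \<tau> m i s" "step_index \<tau> m k u" "s \<le> u" for i k s u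
  proof (rule ccontr)
    assume "\<not> i \<le> k"
    then have "k < m" using that(1) by (auto simp: step_index_def)
    moreover have "\<tau> (Suc k) \<le> \<tau> i"
      using that(1) \<open>\<not> i \<le> k\<close> \<tau>(2)[of "Suc k" i] by (cases "Suc k = i") (auto simp: step_index_def)
    ultimately show False using that by (auto simp: step_index_def)
  qed
  obtain a b where ab: "0 \<le> a" "a < b" "b \<le> v" "p \<le> x a" "x b < q" "downs x p q n a" using Suc.prems by auto
  obtain ia where ia: "step_index \<tau> m ia a" using I_ex ab by blast
  obtain ib where ib: "step_index \<tau> m ib b" using I_ex[of b] ab by auto
  have "ia \<le> ib" "ib \<le> i" using I_mono[OF ia ib] I_mono[OF ib Suc.prems(3)] ab by auto
  moreover have "y \<le> W ia" "W ib < y" using W ia ib ab Suc.prems by auto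
  ultimately obtain j where j: "ia \<le> j" "j < ib" "y \<le> W j" "W (Suc j) < y"
    using exists_downward_step[of ia ib y W] by blast
  have "n \<le> card {j. j < ia \<and> y \<le> W j \<and> W (Suc j) < y}" using Suc.IH[of a ia] ab ia Suc.prems by auto
  also have "\<dots> < card {j. j < i \<and> y \<le> W j \<and> W (Suc j) < y}"
  proof (rule psubset_card_mono)
    show "finite {j. j < i \<and> y \<le> W j \<and> W (Suc j) < y}" by simp
    have "ia \<le> i" "j < i" "\<not> j < ia" using j(1,2) \<open>ia \<le> ib\<close> \<open>ib \<le> i\<close> by linarith+
    moreover have "{j. j < ia \<and> y \<le> W j \<and> W (Suc j) < y} \<subseteq> {j. j < i \<and> y \<le> W j \<and> W (Suc j) < y}"
      using \<open>ia \<le> i\<close> by (intro Collect_mono) simp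
    ultimately show "{j. j < ia \<and> y \<le> W j \<and> W (Suc j) < y} \<subset> {j. j < i \<and> y \<le> W j \<and> W (Suc j) < y}"
      using j(3,4) by blast
  qed
  finally show ?case by simp
qed simp

text \<open>Each value differs by at most \<open>1\<close> from the value at the last time of the
  finite set \<open>G\<close> that does not exceed \<open>u\<close>.\<close>

lemma cadlag_bounded:
  assumes "cadlag x" "0 \<le> T"
  obtains R where "R \<ge> 0" "\<And>u. u \<in> {0..T} \<Longrightarrow> \<bar>x u\<bar> \<le> R"
proof -
  obtain F where F: "finite F" "\<And>u v. 0 \<le> u \<Longrightarrow> u \<le> v \<Longrightarrow> v \<le> T \<Longrightarrow> F \<inter> {u<..v} = {} \<Longrightarrow> \<bar>x u - x v\<bar> \<le> 1"
    using finite_oscillation_set[OF assms, of 1] by auto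
  define G where "G = insert 0 (F \<inter> {0..T})"
  have G: "finite G" using F by (auto simp: G_def)
  define R where "R = (\<Sum>v\<in>G. \<bar>x v\<bar>) + 1"
  have "R \<ge> 0" by (auto simp: R_def intro!: add_nonneg_nonneg sum_nonneg)
  moreover have "\<bar>x u\<bar> \<le> R" if u: "u \<in> {0..T}" for u
  proof -
    define g where "g = Max (G \<inter> {..u})"
    have fin: "finite (G \<inter> {..u})" using G by auto
    have g: "g \<in> G \<inter> {..u}" unfolding g_def using fin u by (intro Max_in) (auto simp: G_def)
    have "F \<inter> {g<..u} = {}"
    proof (rule ccontr)
      assume "F \<inter> {g<..u} \<noteq> {}"
      then obtain f where f: "f \<in> F" "g < f" "f \<le> u" by auto
      then have "f \<in> G \<inter> {..u}" using g u by (auto simp: G_def)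
      then have "f \<le> g" unfolding g_def using fin by (intro Max_ge)
      then show False using f by simp
    qed
    then have "\<bar>x g - x u\<bar> \<le> 1" using F(2)[of g u] g u by (auto simp: G_def)
    moreover have "\<bar>x g\<bar> \<le> (\<Sum>v\<in>G. \<bar>x v\<bar>)" using G g by (intro member_le_sum[of g G "\<lambda>v. \<bar>x v\<bar>"]) auto
    ultimately show ?thesis by (auto simp: R_def)
  qed
  ultimately show thesis using that by blast
qed

text \<open>If \<open>x\<close> oscillates by at most \<open>c / 4\<close> between samples, the
  sample next to either end of a downcrossing is on the same side of \<open>y\<close> as that end.
  Hence the number \<open>m\<close> of steps bounds the count; it does not depend on
  \<open>y\<close>, which integrability over the levels relies on.\<close>

lemma downs_uniformly_bounded:
  assumes x: "cadlag x" and c: "c > 0" and t: "0 \<le> t"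
  shows "\<exists>N. \<forall>y n. downs x (y + c / 2) (y - c / 2) n t \<longrightarrow> n \<le> N"
proof -
  obtain \<tau> :: "nat \<Rightarrow> real" and m where \<tau>: "\<tau> 0 = 0" "\<tau> m = t" "\<And>i j. i < j \<Longrightarrow> j \<le> m \<Longrightarrow> \<tau> i < \<tau> j"
    "\<And>i u v. i < m \<Longrightarrow> u \<in> {\<tau> i..<\<tau> (Suc i)} \<Longrightarrow> v \<in> {\<tau> i..<\<tau> (Suc i)} \<Longrightarrow> \<bar>x u - x v\<bar> \<le> c / 4"
    using cadlag_partition[OF x t, of "c / 4"] c by auto
  have osc: "\<bar>x (\<tau> i) - x s\<bar> \<le> c / 4" if "step_index \<tau> m i s" "s \<le> t" for i s
  proof (cases "i = m")
    case True
    then show ?thesis using that \<tau>(2) c by (auto simp: step_index_def)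
  qed (use that \<tau>(4)[of i "\<tau> i" s] in \<open>auto simp: step_index_def\<close>)
  have "n \<le> m" if "downs x (y + c / 2) (y - c / 2) n t" for y n
  proof -
    have "n \<le> card {j. j < m \<and> y \<le> x (\<tau> j) \<and> x (\<tau> (Suc j)) < y}"
    proof (rule downs_le_downward_steps[where W = "\<lambda>j. x (\<tau> j)" and \<tau> = \<tau> and m = m])
      show "\<tau> 0 = 0" by fact
      show "\<tau> i < \<tau> j" if "i < j" "j \<le> m" for i j using \<tau>(3) that .
      show "downs x (y + c / 2) (y - c / 2) n t" by fact
      show "t \<le> t" ..
      fix i s assume a: "step_index \<tau> m i s" "s \<le> t"
      show "y \<le> x (\<tau> i)" if "y + c / 2 \<le> x s" using osc[OF a] that c by linarith
      show "x (\<tau> i) < y" if "x s < y - c / 2" using osc[OF a] that c by linarith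
    qed (use \<tau>(2) in \<open>auto simp: step_index_def\<close>)
    also have "\<dots> \<le> card {..<m}" by (intro card_mono) auto
    finally show ?thesis by simp
  qed
  then show ?thesis by blast
qed

section \<open>The number of downcrossings as a function of time and level\<close>

text \<open>The set under \<open>Max\<close> is finite, contains \<open>0\<close> and is downward
  closed, so it consists of all numbers up to its maximum. Later arguments use this characterization
  in place of the crossing times.\<close>

lemma le_dcross_iff:
  assumes x: "cadlag x" and c: "c > 0" and t: "0 \<le> t"
  shows "n \<le> dcross y c x 0 t \<longleftrightarrow> downs x (y + c / 2) (y - c / 2) n t"
proof -
  define S where "S = {n. downs x (y + c / 2) (y - c / 2) n t}"
  obtain N where "\<forall>y n. downs x (y + c / 2) (y - c / 2) n t \<longrightarrow> n \<le> N"
    using downs_uniformly_bounded[OF assms] ..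
  then have "S \<subseteq> {..N}" by (auto simp: S_def)
  then have fin: "finite S" by (rule finite_subset) simp
  have "0 \<in> S" by (simp add: S_def)
  have d: "dcross y c x 0 t = Max S"
    using sigma_le_iff_downs[OF assms] by (simp add: dcross_def S_def)
  have "dcross y c x 0 t \<in> S" unfolding d using fin \<open>0 \<in> S\<close> by (intro Max_in) auto
  then have "n \<in> S" if "n \<le> dcross y c x 0 t" using downs_le[OF that] by (simp add: S_def)
  moreover have "n \<le> dcross y c x 0 t" if "n \<in> S" using fin that unfolding d by simp
  ultimately show ?thesis unfolding S_def by blast
qed

lemma downs_dcross:
  "cadlag x \<Longrightarrow> c > 0 \<Longrightarrow> 0 \<le> t \<Longrightarrow> downs x (y + c / 2) (y - c / 2) (dcross y c x 0 t) t"
  using le_dcross_iff by blast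

lemma dcross_mono:
  assumes "cadlag x" "c > 0" "0 \<le> s" "s \<le> t"
  shows "dcross y c x 0 s \<le> dcross y c x 0 t"
proof -
  have "downs x (y + c / 2) (y - c / 2) (dcross y c x 0 s) t"
    using downs_dcross[of x c s y] downs_mono_time assms by blast
  then show ?thesis using le_dcross_iff[of x c t] assms by simp
qed

lemma dcross_support:
  assumes "cadlag x" "c > 0" "0 \<le> t" "\<And>u. u \<in> {0..t} \<Longrightarrow> \<bar>x u\<bar> \<le> R" "dcross y c x 0 t \<noteq> 0"
  shows "\<bar>y\<bar> \<le> R"
proof -
  have "1 \<le> dcross y c x 0 t" using assms by simp
  then obtain a b where "0 \<le> a" "a < b" "b \<le> t" "y + c / 2 \<le> x a" "x b < y - c / 2"
    using le_dcross_iff[OF assms(1-3)] by auto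
  then show ?thesis using assms(2) assms(4)[of a] assms(4)[of b] by auto
qed

text \<open>On \<open>{s..<t}\<close> the path stays on one side of \<open>y\<close>. If the last
  but one downcrossing ended after \<open>s\<close>, then its end \<open>b'\<close> and the start
  \<open>a\<close> of the last one would be times in \<open>{s..<t}\<close> on opposite sides of
  \<open>y\<close>. So at most the last downcrossing is not complete by time \<open>s\<close>; it
  may end with a jump at \<open>t\<close>, where the oscillation bound says nothing.\<close>

lemma dcross_local:
  assumes x: "cadlag x" and c: "c > 0" and st: "0 \<le> s" "s \<le> t"
    and osc: "\<And>u. u \<in> {s..<t} \<Longrightarrow> \<bar>x u - x s\<bar> \<le> e" and y: "e < \<bar>y - x s\<bar>"
  shows "dcross y c x 0 t \<le> dcross y c x 0 s + 1"
proof (cases "dcross y c x 0 t")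
  case (Suc k)
  show ?thesis
  proof (cases k)
    case (Suc n)
    have "downs x (y + c / 2) (y - c / 2) (Suc (Suc n)) t"
      using downs_dcross[OF x c, of t y] st Suc \<open>dcross y c x 0 t = _\<close> by simp
    then obtain a b where ab: "0 \<le> a" "a < b" "b \<le> t" "y + c / 2 \<le> x a"
      "downs x (y + c / 2) (y - c / 2) (Suc n) a" by auto
    then obtain a' b' where ab': "0 \<le> a'" "a' < b'" "b' \<le> a" "y + c / 2 \<le> x a'" "x b' < y - c / 2"
      "downs x (y + c / 2) (y - c / 2) n a'" by auto
    have "b' \<le> s"
    proof (rule ccontr)
      assume "\<not> b' \<le> s"
      then have "\<bar>x a - x s\<bar> \<le> e" "\<bar>x b' - x s\<bar> \<le> e" using osc ab ab' by auto
      then show False using y c ab ab' by linarith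
    qed
    then have "downs x (y + c / 2) (y - c / 2) (Suc n) s" using ab' by (intro downs_SucI)
    then have "Suc n \<le> dcross y c x 0 s" using le_dcross_iff[OF x c st(1)] by blast
    then show ?thesis using \<open>dcross y c x 0 t = _\<close> Suc by simp
  qed (use Suc in simp)
qed simp

text \<open>
  The set of \<open>y\<close> with at least \<open>n\<close> downcrossings is a countable union of intervals: since the lower
  level is crossed strictly, it can be raised to a rational \<open>q\<close>, and for fixed \<open>q\<close> the set is downward
  closed in \<open>y\<close>.
\<close>

lemma dcross_borel_measurable:
  assumes x: "cadlag x" and c: "c > 0" and t: "0 \<le> t"
  shows "(\<lambda>y. real (dcross y c x 0 t)) \<in> borel_measurable borel"
proof (rule borel_measurableI_ge)
  fix r :: real
  have "{y \<in> space borel. r \<le> real (dcross y c x 0 t)} = {y. nat \<lceil>r\<rceil> \<le> dcross y c x 0 t}"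
    by (auto simp: nat_ceiling_le_eq)
  also have "\<dots> = {y. downs x (y + c / 2) (y - c / 2) (nat \<lceil>r\<rceil>) t}"
    using le_dcross_iff[OF assms] by auto
  also have "\<dots> = (\<Union>q\<in>\<rat>. {y. q + c / 2 \<le> y} \<inter> {y. downs x (y + c / 2) q (nat \<lceil>r\<rceil>) t})" (is "?L = ?R")
  proof
    show "?L \<subseteq> ?R"
    proof
      fix y assume "y \<in> ?L"
      then obtain q' where q': "q' < y - c / 2" "downs x (y + c / 2) q' (nat \<lceil>r\<rceil>) t"
        using downs_lower_level by blast
      then obtain q where "q \<in> \<rat>" "q' < q" "q < y - c / 2" using Rats_dense_in_real by blast
      then show "y \<in> ?R" using downs_mono_levels[OF q'(2), of "y + c / 2" q] by (intro UN_I[of q]) auto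
    qed
    show "?R \<subseteq> ?L" by (auto intro: downs_mono_levels)
  qed
  also have "\<dots> \<in> sets borel"
  proof (rule sets.countable_UN''[OF countable_rat], rule sets.Int)
    fix q :: real
    show "{y. downs x (y + c / 2) q (nat \<lceil>r\<rceil>) t} \<in> sets borel"
      by (rule real_interval_borel_measurable)
        (auto simp: is_interval_1 intro: downs_mono_levels)
  qed auto
  finally show "{y \<in> space borel. r \<le> real (dcross y c x 0 t)} \<in> sets borel" .
qed

lemma dcross_integrable:
  assumes x: "cadlag x" and c: "c > 0" and t: "0 \<le> t"
  shows "integrable lborel (\<lambda>y. real (dcross y c x 0 t))"
proof -
  obtain N where N: "\<forall>y n. downs x (y + c / 2) (y - c / 2) n t \<longrightarrow> n \<le> N"
    using downs_uniformly_bounded[OF assms] ..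
  obtain R where R: "R \<ge> 0" "\<And>u. u \<in> {0..t} \<Longrightarrow> \<bar>x u\<bar> \<le> R" using cadlag_bounded[OF x t] by blast
  show ?thesis
  proof (rule Bochner_Integration.integrable_bound)
    show "integrable lborel (\<lambda>y. real N * indicator {-R..R} y)"
      by (intro integrable_mult_right integrable_real_indicator) (auto simp: R(1))
    show "(\<lambda>y. real (dcross y c x 0 t)) \<in> borel_measurable lborel"
      using dcross_borel_measurable[OF assms] by simp
    show "AE y in lborel. norm (real (dcross y c x 0 t)) \<le> norm (real N * indicator {-R..R} y)"
    proof (rule AE_I2)
      fix y
      show "norm (real (dcross y c x 0 t)) \<le> norm (real N * indicator {-R..R} y :: real)"
      proof (cases "dcross y c x 0 t = 0")
        case False
        then have "\<bar>y\<bar> \<le> R" using dcross_support[OF assms R(2)] by blast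
        then have "y \<in> {-R..R}" by auto
        then show ?thesis using N downs_dcross[OF assms, of y] by simp
      qed simp
    qed
  qed
qed

section \<open>Partition sums bounded by integrated downcrossings\<close>

text \<open>The interval with the largest right end provides the last downcrossing. Since interiors
  are disjoint, all other intervals end no later than its left end, and the induction applies to
  them.\<close>

lemma downs_card_intervals:
  assumes "finite S" "q \<le> p"
    and "\<And>K. K \<in> S \<Longrightarrow> \<exists>a b. K = {a..b} \<and> 0 \<le> a \<and> a < b \<and> b \<le> t \<and> p \<le> x a \<and> x b < q"
    and "\<And>K L. K \<in> S \<Longrightarrow> L \<in> S \<Longrightarrow> K \<noteq> L \<Longrightarrow> interior K \<inter> interior L = {}"
  shows "downs x p q (card S) t"
  using assms
proof (induction "card S" arbitrary: S t)
  case (Suc n)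
  have ne: "S \<noteq> {}" using Suc by auto
  have "Max (Sup ` S) \<in> Sup ` S" using Suc.prems ne by (intro Max_in) auto
  then obtain K where K: "K \<in> S" "Sup K = Max (Sup ` S)" by (metis image_iff)
  have max: "Sup L \<le> Sup K" if "L \<in> S" for L using K that Suc.prems by simp
  obtain a b where ab: "K = {a..b}" "0 \<le> a" "a < b" "b \<le> t" "p \<le> x a" "x b < q" using Suc.prems(3) K by blast
  have card: "card (S - {K}) = n" using Suc.hyps(2) K Suc.prems by simp
  have "downs x p q (card (S - {K})) a"
  proof (rule Suc.hyps(1))
    fix L assume L: "L \<in> S - {K}"
    then obtain a' b' where ab': "L = {a'..b'}" "0 \<le> a'" "a' < b'" "b' \<le> t" "p \<le> x a'" "x b' < q"
      using Suc.prems(3) by blast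
    have "b' \<le> b" using max[of L] L ab ab' by auto
    have "b' \<le> a"
    proof (rule ccontr)
      assume "\<not> b' \<le> a"
      then have "max a a' < b'" using ab' by auto
      then obtain z where "max a a' < z" "z < b'" using dense by blast
      then have "z \<in> interior K \<inter> interior L" using ab ab' \<open>b' \<le> b\<close> by (auto simp: interior_atLeastAtMost_real)
      then show False using Suc.prems(4)[of K L] K L by auto
    qed
    then show "\<exists>a' b'. L = {a'..b'} \<and> 0 \<le> a' \<and> a' < b' \<and> b' \<le> a \<and> p \<le> x a' \<and> x b' < q"
      using ab' by blast
  qed (use card Suc.prems in auto)
  then have "downs x p q (Suc n) t" unfolding card using ab by (intro downs_SucI)
  then show ?case using Suc.hyps(2) by simp
qed simp

lemma division_of_Icc_cases:
  fixes \<pi> :: "real set set"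
  assumes "\<pi> division_of {s..t}" "K \<in> \<pi>"
  obtains a b where "K = {a..b}" "s \<le> a" "a \<le> b" "b \<le> t" "Inf K = a" "Sup K = b"
proof -
  have "K \<subseteq> {s..t}" "K \<noteq> {}" "\<exists>a b. K = cbox a b" using division_ofD[OF assms(1)] assms(2) by auto
  then obtain a b where "K = {a..b}" "a \<le> b" by auto
  then show thesis using that[of a b] \<open>K \<subseteq> {s..t}\<close> by auto
qed

text \<open>Each summand is the length of the set \<open>A K\<close> of levels \<open>y\<close> for
  which \<open>x\<close> passes from at least \<open>y + c / 2\<close> to below
  \<open>y - c / 2\<close> over the interval \<open>K\<close>. After exchanging sum and integral,
  the intervals \<open>K\<close> with \<open>y\<close> in \<open>A K\<close> are non-overlapping and
  give that many downcrossings.\<close>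

lemma down_sum_le_integral_dcross:
  assumes x: "cadlag x" and c: "c > 0" and t: "0 \<le> t" and \<pi>: "\<pi> division_of {0..t}"
  shows "(\<Sum>K\<in>\<pi>. max (x (Inf K) - x (Sup K) - c) 0) \<le> (LINT y|lborel. real (dcross y c x 0 t))"
proof -
  define A where "A K = {y. y + c / 2 \<le> x (Inf K) \<and> x (Sup K) < y - c / 2}" for K
  have A: "A K = {x (Sup K) + c / 2<..x (Inf K) - c / 2}" for K by (auto simp: A_def)
  have fin: "finite \<pi>" using \<pi> by auto
  have int: "integrable lborel (\<lambda>y. indicator (A K) y :: real)" for K
    unfolding A by (cases "x (Sup K) + c / 2 \<le> x (Inf K) - c / 2") (auto intro!: integrable_real_indicator)
  have "(LINT y|lborel. indicator (A K) y) = max (x (Inf K) - x (Sup K) - c) 0" for K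
    unfolding A by (cases "x (Sup K) + c / 2 \<le> x (Inf K) - c / 2") (auto simp: max_def)
  then have "(\<Sum>K\<in>\<pi>. max (x (Inf K) - x (Sup K) - c) 0) = (\<Sum>K\<in>\<pi>. (LINT y|lborel. indicator (A K) y))"
    by simp
  also have "\<dots> = (LINT y|lborel. (\<Sum>K\<in>\<pi>. indicator (A K) y))"
    using int by (intro Bochner_Integration.integral_sum[symmetric])
  also have "\<dots> \<le> (LINT y|lborel. real (dcross y c x 0 t))"
  proof (rule integral_mono)
    show "integrable lborel (\<lambda>y. \<Sum>K\<in>\<pi>. indicator (A K) y :: real)"
      using int by (intro Bochner_Integration.integrable_sum)
    show "integrable lborel (\<lambda>y. real (dcross y c x 0 t))" by (rule dcross_integrable[OF x c t])
    fix y
    let ?S = "{K \<in> \<pi>. y \<in> A K}"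
    have "downs x (y + c / 2) (y - c / 2) (card ?S) t"
    proof (rule downs_card_intervals)
      fix K assume "K \<in> ?S"
      then have K: "K \<in> \<pi>" "y \<in> A K" by auto
      obtain a b where ab: "K = {a..b}" "0 \<le> a" "a \<le> b" "b \<le> t" "Inf K = a" "Sup K = b"
        using division_of_Icc_cases[OF \<pi> K(1)] by metis
      moreover have "a \<noteq> b" using K(2) ab c by (auto simp: A_def)
      ultimately show "\<exists>a b. K = {a..b} \<and> 0 \<le> a \<and> a < b \<and> b \<le> t \<and> y + c / 2 \<le> x a \<and> x b < y - c / 2"
        using K(2) by (intro exI[of _ a] exI[of _ b]) (auto simp: A_def)
    qed (use fin c division_ofD(5)[OF \<pi>] in auto)
    then have "card ?S \<le> dcross y c x 0 t" using le_dcross_iff[OF x c t] by blast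
    moreover have "(\<Sum>K\<in>\<pi>. indicator (A K) y :: real) = real (card ?S)"
      using fin by (simp add: indicator_def sum.If_cases Int_def)
    ultimately show "(\<Sum>K\<in>\<pi>. indicator (A K) y) \<le> real (dcross y c x 0 t)" by simp
  qed
  finally show ?thesis .
qed

section \<open>Truncated variation and the integrated number of crossings\<close>

lemma TV_leI:
  "(\<And>\<pi>. \<pi> division_of {s..t} \<Longrightarrow> (\<Sum>K\<in>\<pi>. max (\<bar>x (Sup K) - x (Inf K)\<bar> - c) 0) \<le> B) \<Longrightarrow> TV c x s t \<le> ereal B"
  unfolding TV_def by (rule SUP_least) simp

lemma TV_upper:
  "\<pi> division_of {s..t} \<Longrightarrow> ereal (\<Sum>K\<in>\<pi>. max (\<bar>x (Sup K) - x (Inf K)\<bar> - c) 0) \<le> TV c x s t"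
  unfolding TV_def by (rule SUP_upper) simp

lemma TV_uminus: "TV c (\<lambda>u. - x u) s t = TV c x s t"
  unfolding TV_def by (simp add: abs_minus_commute)

lemma UTV_eq_DTV_uminus: "UTV c x s t = DTV c (\<lambda>u. - x u) s t"
  unfolding UTV_def DTV_def by simp

lemma division_of_Icc_exists: "\<exists>\<pi>. \<pi> division_of {s..t::real}"
  by (metis elementary_interval box_real(2))

lemma TV_nonneg: "0 \<le> TV c x s t"
proof -
  obtain \<pi> where "\<pi> division_of {s..t}" using division_of_Icc_exists by blast
  have "0 \<le> ereal (\<Sum>K\<in>\<pi>. max (\<bar>x (Sup K) - x (Inf K)\<bar> - c) 0)" by (auto intro: sum_nonneg)
  also have "\<dots> \<le> TV c x s t" by (rule TV_upper) fact
  finally show ?thesis .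
qed

lemma DTV_nonneg: "0 \<le> DTV c x s t"
proof -
  obtain \<pi> where \<pi>: "\<pi> division_of {s..t}" using division_of_Icc_exists by blast
  have "0 \<le> ereal (\<Sum>K\<in>\<pi>. max (x (Inf K) - x (Sup K) - c) 0)" by (auto intro: sum_nonneg)
  also have "\<dots> \<le> DTV c x s t" unfolding DTV_def using \<pi> by (intro SUP_upper) simp
  finally show ?thesis .
qed

text \<open>For \<open>c \<ge> 0\<close> at most one of the two one-sided excesses is positive, so
  on a common partition the two-sided sum equals the sum of the one-sided ones.\<close>

lemma TV_le_UTV_DTV:
  assumes "0 \<le> c"
  shows "TV c x s t \<le> UTV c x s t + DTV c x s t"
  unfolding TV_def
proof (rule SUP_least)
  fix \<pi> :: "real set set" assume \<pi>: "\<pi> \<in> {\<pi>. \<pi> division_of {s..t}}"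
  have "(\<Sum>K\<in>\<pi>. max (\<bar>x (Sup K) - x (Inf K)\<bar> - c) 0) =
    (\<Sum>K\<in>\<pi>. max (x (Sup K) - x (Inf K) - c) 0) + (\<Sum>K\<in>\<pi>. max (x (Inf K) - x (Sup K) - c) 0)"
    unfolding sum.distrib[symmetric] using assms by (intro sum.cong) auto
  then have "ereal (\<Sum>K\<in>\<pi>. max (\<bar>x (Sup K) - x (Inf K)\<bar> - c) 0) =
    ereal (\<Sum>K\<in>\<pi>. max (x (Sup K) - x (Inf K) - c) 0) + ereal (\<Sum>K\<in>\<pi>. max (x (Inf K) - x (Sup K) - c) 0)"
    by simp
  also have "\<dots> \<le> UTV c x s t + DTV c x s t"
    unfolding UTV_def DTV_def using \<pi> by (intro add_mono SUP_upper)
  finally show "ereal (\<Sum>K\<in>\<pi>. max (\<bar>x (Sup K) - x (Inf K)\<bar> - c) 0) \<le> UTV c x s t + DTV c x s t" .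
qed

lemma DTV_le_integral_dcross:
  assumes "cadlag x" "c > 0" "0 \<le> t"
  shows "DTV c x 0 t \<le> ereal (LINT y|lborel. real (dcross y c x 0 t))"
  unfolding DTV_def by (rule SUP_least) (use down_sum_le_integral_dcross[OF assms] in simp)

text \<open>The integrated crossing numbers are finite upper bounds, so the extended-real suprema
  may be treated as real numbers from here on.\<close>

lemma TV_finite:
  assumes x: "cadlag x" and c: "c > 0" and t: "0 \<le> t"
  shows "TV c x 0 t = ereal (real_of_ereal (TV c x 0 t))"
    and "DTV c x 0 t = ereal (real_of_ereal (DTV c x 0 t))"
    and "UTV c x 0 t = ereal (real_of_ereal (UTV c x 0 t))"
proof -
  have fin: "v = ereal (real_of_ereal v)" if "0 \<le> v" "v \<le> ereal B" for v B
    using that by (cases v) auto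
  show D: "DTV c x 0 t = ereal (real_of_ereal (DTV c x 0 t))"
    using fin[OF DTV_nonneg DTV_le_integral_dcross[OF assms]] .
  show U: "UTV c x 0 t = ereal (real_of_ereal (UTV c x 0 t))"
    using fin[OF DTV_nonneg DTV_le_integral_dcross[OF cadlag_uminus[OF x] c t]]
    unfolding UTV_eq_DTV_uminus .
  have "TV c x 0 t \<le> ereal (real_of_ereal (UTV c x 0 t) + real_of_ereal (DTV c x 0 t))"
    using TV_le_UTV_DTV[of c x 0 t] c U D by (metis less_imp_le plus_ereal.simps(1))
  then show "TV c x 0 t = ereal (real_of_ereal (TV c x 0 t))" using fin[OF TV_nonneg] by blast
qed

lemma division_of_insert_Icc:
  fixes a s t :: real
  assumes \<pi>: "\<pi> division_of {a..s}" and st: "a \<le> s" "s < t"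
  shows "insert {s..t} \<pi> division_of {a..t}" and "{s..t} \<notin> \<pi>"
proof -
  have div: "{{s..t}} division_of {s..t}" using division_of_self[of s t] st by simp
  have "interior {a..s} \<inter> interior {s..t} = {}" by (auto simp: interior_atLeastAtMost_real)
  then have "\<pi> \<union> {{s..t}} division_of ({a..s} \<union> {s..t})" by (rule division_disjoint_union[OF \<pi> div])
  also have "{a..s} \<union> {s..t} = {a..t}" using st by auto
  finally show "insert {s..t} \<pi> division_of {a..t}" by simp
  show "{s..t} \<notin> \<pi>"
  proof
    assume "{s..t} \<in> \<pi>"
    then have "{s..t} \<subseteq> {a..s}" using \<pi> by auto
    then show False using st by auto
  qed
qed

lemma DTV_mono:
  assumes st: "0 \<le> s" "s \<le> t"
  shows "DTV c x 0 s \<le> DTV c x 0 t"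
  unfolding DTV_def
proof (rule SUP_mono)
  fix \<pi> :: "real set set" assume "\<pi> \<in> {\<pi>. \<pi> division_of {0..s}}"
  then have \<pi>: "\<pi> division_of {0..s}" by simp
  show "\<exists>\<pi>'\<in>{\<pi>. \<pi> division_of {0..t}}. ereal (\<Sum>K\<in>\<pi>. max (x (Inf K) - x (Sup K) - c) 0)
    \<le> ereal (\<Sum>K\<in>\<pi>'. max (x (Inf K) - x (Sup K) - c) 0)"
  proof (cases "s = t")
    case False
    then have "s < t" using st by simp
    note ext = division_of_insert_Icc[OF \<pi> st(1) this]
    have "(\<Sum>K\<in>\<pi>. max (x (Inf K) - x (Sup K) - c) 0) \<le> (\<Sum>K\<in>insert {s..t} \<pi>. max (x (Inf K) - x (Sup K) - c) 0)"
      by (intro sum_mono2 division_of_finite[OF ext(1)] subset_insertI max.cobounded2)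
    then show ?thesis using ext(1) by (intro bexI[of _ "insert {s..t} \<pi>"]) simp_all
  qed (use \<pi> in \<open>intro bexI[of _ \<pi>], simp_all\<close>)
qed

text \<open>A partition of \<open>{0..s}\<close> is extended by the single interval
  \<open>{s..t}\<close>. The case \<open>s = t\<close> is separate because this interval must be
  non-degenerate to be new; the added term vanishes there.\<close>

lemma TV_superadditive:
  assumes x: "cadlag x" and c: "c > 0" and st: "0 \<le> s" "s \<le> t"
  shows "real_of_ereal (TV c x 0 s) + max (\<bar>x t - x s\<bar> - c) 0 \<le> real_of_ereal (TV c x 0 t)"
proof -
  have "TV c x 0 s \<le> ereal (real_of_ereal (TV c x 0 t) - max (\<bar>x t - x s\<bar> - c) 0)"
  proof (rule TV_leI)
    fix \<pi> assume \<pi>: "\<pi> division_of {0..s}"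
    show "(\<Sum>K\<in>\<pi>. max (\<bar>x (Sup K) - x (Inf K)\<bar> - c) 0) \<le> real_of_ereal (TV c x 0 t) - max (\<bar>x t - x s\<bar> - c) 0"
    proof (cases "s = t")
      case True
      have "ereal (\<Sum>K\<in>\<pi>. max (\<bar>x (Sup K) - x (Inf K)\<bar> - c) 0) \<le> ereal (real_of_ereal (TV c x 0 t))"
        using TV_upper[OF \<pi>, of x c] TV_finite(1)[OF x c, of t] True st by simp
      then show ?thesis using True c by simp
    next
      case False
      then have "s < t" using st by simp
      note ext = division_of_insert_Icc[OF \<pi> st(1) this]
      have "(\<Sum>K\<in>insert {s..t} \<pi>. max (\<bar>x (Sup K) - x (Inf K)\<bar> - c) 0) =
        (\<Sum>K\<in>\<pi>. max (\<bar>x (Sup K) - x (Inf K)\<bar> - c) 0) + max (\<bar>x t - x s\<bar> - c) 0"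
        using ext(2) st division_of_finite[OF \<pi>] by simp
      moreover have "ereal (\<Sum>K\<in>insert {s..t} \<pi>. max (\<bar>x (Sup K) - x (Inf K)\<bar> - c) 0) \<le> ereal (real_of_ereal (TV c x 0 t))"
        using TV_upper[OF ext(1), of x c] TV_finite(1)[OF x c, of t] st by simp
      ultimately show ?thesis by simp
    qed
  qed
  moreover have "TV c x 0 s = ereal (real_of_ereal (TV c x 0 s))" using TV_finite(1)[OF x c st(1)] .
  ultimately have "ereal (real_of_ereal (TV c x 0 s)) \<le> ereal (real_of_ereal (TV c x 0 t) - max (\<bar>x t - x s\<bar> - c) 0)"
    by simp
  then show ?thesis by simp
qed

text \<open>A consequence of the convexity of the truncated variation in \<open>c\<close>.\<close>

lemma TV_convex_step:
  assumes x: "cadlag x" and c: "c > 0" and t: "0 \<le> t" and l: "0 < l" "l < 1"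
  shows "real_of_ereal (TV (c - l * (c / 2)) x 0 t) \<le>
    real_of_ereal (TV c x 0 t) + l * real_of_ereal (TV (c / 2) x 0 t)"
proof -
  have "l * (c / 2) < 1 * c" using l c by (intro mult_strict_mono) auto
  then have c': "c - l * (c / 2) > 0" by simp
  have "TV (c - l * (c / 2)) x 0 t \<le> ereal (real_of_ereal (TV c x 0 t) + l * real_of_ereal (TV (c / 2) x 0 t))"
  proof (rule TV_leI)
    fix \<pi> assume \<pi>: "\<pi> division_of {0..t}"
    have key: "max (a - (c - l * (c / 2))) 0 \<le> max (a - c) 0 + l * max (a - c / 2) 0" for a
    proof -
      \<comment> \<open>The level \<open>c - l * (c / 2)\<close> is the convex combination of
        \<open>c\<close> and \<open>c / 2\<close> with weights \<open>1 - l\<close> and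
        \<open>l\<close>; afterwards the weight \<open>1 - l\<close> is estimated by
        \<open>1\<close>.\<close>
      have "a - (c - l * (c / 2)) = (1 - l) * (a - c) + l * (a - c / 2)" by (simp add: algebra_simps)
      also have "\<dots> \<le> 1 * max (a - c) 0 + l * max (a - c / 2) 0"
      proof (intro add_mono mult_left_mono)
        have "(1 - l) * (a - c) \<le> (1 - l) * max (a - c) 0" using l by (intro mult_left_mono) auto
        also have "\<dots> \<le> 1 * max (a - c) 0" using l by (intro mult_right_mono) auto
        finally show "(1 - l) * (a - c) \<le> 1 * max (a - c) 0" .
      qed (use l in auto)
      finally show ?thesis using l by auto
    qed
    have "(\<Sum>K\<in>\<pi>. max (\<bar>x (Sup K) - x (Inf K)\<bar> - (c - l * (c / 2))) 0)
      \<le> (\<Sum>K\<in>\<pi>. max (\<bar>x (Sup K) - x (Inf K)\<bar> - c) 0) + l * (\<Sum>K\<in>\<pi>. max (\<bar>x (Sup K) - x (Inf K)\<bar> - c / 2) 0)"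
      unfolding sum_distrib_left sum.distrib[symmetric] by (intro sum_mono key)
    moreover have "ereal (\<Sum>K\<in>\<pi>. max (\<bar>x (Sup K) - x (Inf K)\<bar> - c) 0) \<le> ereal (real_of_ereal (TV c x 0 t))"
      using TV_upper[OF \<pi>, of x c] TV_finite(1)[OF x c t] by simp
    moreover have "ereal (\<Sum>K\<in>\<pi>. max (\<bar>x (Sup K) - x (Inf K)\<bar> - c / 2) 0) \<le> ereal (real_of_ereal (TV (c / 2) x 0 t))"
      using TV_upper[OF \<pi>, of x "c / 2"] TV_finite(1)[OF x _ t, of "c / 2"] c by simp
    then have "l * (\<Sum>K\<in>\<pi>. max (\<bar>x (Sup K) - x (Inf K)\<bar> - c / 2) 0) \<le> l * real_of_ereal (TV (c / 2) x 0 t)"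
      using l by (intro mult_left_mono) auto
    ultimately show "(\<Sum>K\<in>\<pi>. max (\<bar>x (Sup K) - x (Inf K)\<bar> - (c - l * (c / 2))) 0)
      \<le> real_of_ereal (TV c x 0 t) + l * real_of_ereal (TV (c / 2) x 0 t)" by simp
  qed
  then have "ereal (real_of_ereal (TV (c - l * (c / 2)) x 0 t)) \<le> ereal (real_of_ereal (TV c x 0 t) + l * real_of_ereal (TV (c / 2) x 0 t))"
    using TV_finite(1)[OF x c' t] by simp
  then show ?thesis by simp
qed

lemma TV_degenerate:
  assumes c: "0 < c"
  shows "TV c x 0 0 = 0"
proof (rule antisym)
  have "TV c x 0 0 \<le> ereal 0"
  proof (rule TV_leI)
    fix \<pi> :: "real set set" assume \<pi>: "\<pi> division_of {0..0}"
    have "Inf K = 0 \<and> Sup K = 0" if "K \<in> \<pi>" for K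
      by (rule division_of_Icc_cases[OF \<pi> that]) auto
    then show "(\<Sum>K\<in>\<pi>. max (\<bar>x (Sup K) - x (Inf K)\<bar> - c) 0) \<le> 0" using c by simp
  qed
  then show "TV c x 0 0 \<le> 0" by (simp only: zero_ereal_def)
qed (rule TV_nonneg)

text \<open>
  The gap between \<open>c'\<close> and \<open>c\<close> leaves room to sample \<open>x\<close> at finitely many times without losing crossings.
\<close>

lemma integral_dcross_le_TV_smaller:
  assumes x: "cadlag x" and c: "0 < c'" "c' < c" and t: "0 \<le> t"
  shows "2 * (LINT y|lborel. real (dcross y c x 0 t)) \<le> real_of_ereal (TV c' x 0 t) + x 0 - x t + c'"
proof -
  have c0: "c > 0" using c by simp
  define T where "T s = real_of_ereal (TV c' x 0 s)" for s
  have T: "T s + max (\<bar>x u - x s\<bar> - c') 0 \<le> T u" if "0 \<le> s" "s \<le> u" for s u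
    unfolding T_def using TV_superadditive[OF x c(1) that] .
  have T0: "T 0 = 0" using TV_degenerate[OF c(1)] by (simp add: T_def)
  obtain R where R: "R \<ge> 0" "\<And>u. u \<in> {0..t} \<Longrightarrow> \<bar>x u\<bar> \<le> R" using cadlag_bounded[OF x t] by blast
  have T_mono: "T s \<le> T u" if "0 \<le> s" "s \<le> u" for s u
    using T[OF that] by simp
  \<comment> \<open>Running suprema are the least non-decreasing majorants of \<open>T - x\<close>
    and \<open>T + x\<close>.\<close>
  define P where "P s = (SUP u\<in>{0..s}. T u - x u)" for s
  define Q where "Q s = (SUP u\<in>{0..s}. T u + x u)" for s
  have bdd: "bdd_above ((\<lambda>u. T u - x u) ` {0..s})" "bdd_above ((\<lambda>u. T u + x u) ` {0..s})" if "s \<le> t" for s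
  proof -
    have "T u - x u \<le> T t + R \<and> T u + x u \<le> T t + R" if "u \<in> {0..s}" for u
      using T_mono[of u t] R(2)[of u] that \<open>s \<le> t\<close> by auto
    then show "bdd_above ((\<lambda>u. T u - x u) ` {0..s})" "bdd_above ((\<lambda>u. T u + x u) ` {0..s})"
      by (auto intro!: bdd_aboveI2[where M = "T t + R"])
  qed
  have P_lower: "T s - x s \<le> P s" and Q_lower: "T s + x s \<le> Q s" if "0 \<le> s" "s \<le> t" for s
    unfolding P_def Q_def using that bdd[of s] by (auto intro: cSUP_upper)
  \<comment> \<open>Superadditivity of \<open>T\<close> absorbs a change of \<open>x\<close> up to
    the truncation level, so no earlier value exceeds the present one by more than
    \<open>c'\<close>.\<close>
  have P_upper: "P s \<le> T s - x s + c'" and Q_upper: "Q s \<le> T s + x s + c'" if s: "0 \<le> s" "s \<le> t" for s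
  proof -
    have "T u - x u \<le> T s - x s + c' \<and> T u + x u \<le> T s + x s + c'" if "u \<in> {0..s}" for u
      using T[of u s] that by auto
    then show "P s \<le> T s - x s + c'" "Q s \<le> T s + x s + c'"
      unfolding P_def Q_def using s by (auto intro!: cSUP_least)
  qed
  have P_mono: "P s \<le> P u" and Q_mono: "Q s \<le> Q u" if "0 \<le> s" "s \<le> u" "u \<le> t" for s u
    unfolding P_def Q_def using that bdd[of u] by (auto intro!: cSUP_subset_mono)
  define z where "z s = (Q s - P s) / 2" for s
  have z_lower: "x s - c' / 2 \<le> z s" and z_upper: "z s \<le> x s + c' / 2" if "0 \<le> s" "s \<le> t" for s
    using P_lower[OF that] P_upper[OF that] Q_lower[OF that] Q_upper[OF that] by (auto simp: z_def)
  obtain \<tau> :: "nat \<Rightarrow> real" and m where \<tau>: "\<tau> 0 = 0" "\<tau> m = t" "\<And>i j. i < j \<Longrightarrow> j \<le> m \<Longrightarrow> \<tau> i < \<tau> j"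
    "\<And>i u v. i < m \<Longrightarrow> u \<in> {\<tau> i..<\<tau> (Suc i)} \<Longrightarrow> v \<in> {\<tau> i..<\<tau> (Suc i)} \<Longrightarrow> \<bar>x u - x v\<bar> \<le> (c - c') / 4"
    using cadlag_partition[OF x t, of "(c - c') / 4"] c by auto
  have \<tau>_le: "\<tau> i \<le> \<tau> j" if "i \<le> j" "j \<le> m" for i j using \<tau>(3)[of i j] that by (cases "i = j") auto
  have \<tau>_range: "0 \<le> \<tau> i" "\<tau> i \<le> t" if "i \<le> m" for i
    using \<tau>_le[of 0 i] \<tau>_le[of i m] that \<tau>(1,2) by auto
  have osc: "\<bar>x (\<tau> i) - x s\<bar> \<le> (c - c') / 4" if "step_index \<tau> m i s" "s \<le> t" for i s
  proof (cases "i = m")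
    case True
    then have "s = \<tau> i" using that \<tau>(2) by (auto simp: step_index_def)
    then show ?thesis using c by simp
  qed (use that \<tau>(4)[of i "\<tau> i" s] in \<open>auto simp: step_index_def\<close>)
  define B where "B j = {z (\<tau> (Suc j))<..z (\<tau> j)}" for j
  have dcross_le: "real (dcross y c x 0 t) \<le> (\<Sum>j<m. indicator (B j) y)" for y
  proof -
    have "dcross y c x 0 t \<le> card {j. j < m \<and> y \<le> z (\<tau> j) \<and> z (\<tau> (Suc j)) < y}"
    proof (rule downs_le_downward_steps[where W = "\<lambda>j. z (\<tau> j)" and \<tau> = \<tau> and m = m])
      show "\<tau> 0 = 0" by fact
      show "\<tau> i < \<tau> j" if "i < j" "j \<le> m" for i j using \<tau>(3) that .
      show "downs x (y + c / 2) (y - c / 2) (dcross y c x 0 t) t" using downs_dcross[OF x c0 t] .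
      show "t \<le> t" ..
      show "step_index \<tau> m m t" using \<tau>(2) by (auto simp: step_index_def)
      fix i s assume a: "step_index \<tau> m i s" "s \<le> t"
      have r: "0 \<le> \<tau> i" "\<tau> i \<le> t" using \<tau>_range[of i] a(1) by (auto simp: step_index_def)
      have o: "x s - (c - c') / 4 \<le> x (\<tau> i)" "x (\<tau> i) \<le> x s + (c - c') / 4"
        using osc[OF a] by linarith+
      \<comment> \<open>Sampling costs \<open>(c - c') / 4\<close> and passing from \<open>x\<close>
        to \<open>z\<close> costs \<open>c' / 2\<close>; together this is less than
        \<open>c / 2\<close>.\<close>
      show "y \<le> z (\<tau> i)" if "y + c / 2 \<le> x s"
        using o z_lower[OF r] that c by (simp add: field_simps)
      show "z (\<tau> i) < y" if "x s < y - c / 2"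
        using o z_upper[OF r] that c by (simp add: field_simps)
    qed
    also have "{j. j < m \<and> y \<le> z (\<tau> j) \<and> z (\<tau> (Suc j)) < y} = {j \<in> {..<m}. y \<in> B j}" by (auto simp: B_def)
    finally have "dcross y c x 0 t \<le> card {j \<in> {..<m}. y \<in> B j}" .
    then show ?thesis by (simp add: indicator_def sum.If_cases Int_def)
  qed
  have B_int: "integrable lborel (indicator (B j) :: real \<Rightarrow> real)" for j
    unfolding B_def by (cases "z (\<tau> (Suc j)) \<le> z (\<tau> j)") (auto intro!: integrable_real_indicator)
  \<comment> \<open>As \<open>Q\<close> is non-decreasing, \<open>z\<close> can only fall through
    the growth of \<open>P\<close>. The resulting bounds telescope, so the number of samples
    disappears from the estimate.\<close>
  have B_le: "(LINT y|lborel. indicator (B j) y) \<le> (P (\<tau> (Suc j)) - P (\<tau> j)) / 2" if "j < m" for j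
  proof -
    have "(LINT y|lborel. indicator (B j) y) = max (z (\<tau> j) - z (\<tau> (Suc j))) 0"
      unfolding B_def by (cases "z (\<tau> (Suc j)) \<le> z (\<tau> j)") (auto simp: max_def)
    moreover have "P (\<tau> j) \<le> P (\<tau> (Suc j))" "Q (\<tau> j) \<le> Q (\<tau> (Suc j))"
      using \<tau>_le[of j "Suc j"] \<tau>_range[of j] \<tau>_range[of "Suc j"] that by (auto intro!: P_mono Q_mono)
    ultimately show ?thesis unfolding z_def by (simp add: max_def field_simps)
  qed
  have "(LINT y|lborel. real (dcross y c x 0 t)) \<le> (LINT y|lborel. (\<Sum>j<m. indicator (B j) y))"
    using dcross_le B_int by (intro integral_mono dcross_integrable[OF x c0 t] Bochner_Integration.integrable_sum)
  also have "\<dots> = (\<Sum>j<m. (LINT y|lborel. indicator (B j) y))"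
    using B_int by (intro Bochner_Integration.integral_sum)
  also have "\<dots> \<le> (\<Sum>j<m. (P (\<tau> (Suc j)) - P (\<tau> j)) / 2)"
    using B_le by (intro sum_mono) simp
  also have "\<dots> = (P t - P 0) / 2"
    using \<tau>(1,2) sum_lessThan_telescope[of "\<lambda>j. P (\<tau> j)" m]
    by (simp add: sum_divide_distrib[symmetric])
  finally show ?thesis
    using P_upper[of t] P_lower[of 0] t T0 by (simp add: T_def)
qed

text \<open>The smaller level is taken as \<open>c - l * (c / 2)\<close> with \<open>l\<close>
  tending to \<open>0\<close>. The convexity estimate bounds its truncated variation by that at
  level \<open>c\<close> plus a multiple of \<open>l\<close>, so the gap closes in the
  limit.\<close>

lemma integral_dcross_le_TV:
  assumes x: "cadlag x" and c: "c > 0" and t: "0 \<le> t"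
  shows "2 * (LINT y|lborel. real (dcross y c x 0 t)) \<le> real_of_ereal (TV c x 0 t) + x 0 - x t + c"
proof (rule tendsto_lowerbound)
  let ?f = "\<lambda>l. real_of_ereal (TV c x 0 t) + l * real_of_ereal (TV (c / 2) x 0 t) + x 0 - x t + (c - l * (c / 2))"
  have "((?f) \<longlongrightarrow> real_of_ereal (TV c x 0 t) + 0 * real_of_ereal (TV (c / 2) x 0 t) + x 0 - x t + (c - 0 * (c / 2))) (at_right 0)"
    by (intro tendsto_intros)
  then show "(?f \<longlongrightarrow> real_of_ereal (TV c x 0 t) + x 0 - x t + c) (at_right 0)" by simp
  have "2 * (LINT y|lborel. real (dcross y c x 0 t)) \<le> ?f l" if l: "0 < l" "l < 1" for l
  proof -
    have "l * (c / 2) < 1 * c" using l c by (intro mult_strict_mono) auto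
    then have "0 < c - l * (c / 2)" "c - l * (c / 2) < c" using l c by auto
    from integral_dcross_le_TV_smaller[OF x this t] TV_convex_step[OF x c t l] show ?thesis by simp
  qed
  then show "\<forall>\<^sub>F l in at_right 0. 2 * (LINT y|lborel. real (dcross y c x 0 t)) \<le> ?f l"
    by (intro eventually_at_rightI[of 0 1]) auto
qed simp

text \<open>With \<open>J\<close> and \<open>J'\<close> the integrated downcrossings of
  \<open>x\<close> and \<open>- x\<close>, DTV is at most \<open>J\<close>, UTV is at most
  \<open>J'\<close>, and both \<open>2 * J\<close> and \<open>2 * J'\<close> exceed TV by at most
  \<open>2 * R + c\<close>. Since UTV and DTV add up to at least TV, neither of them can fall short
  of half of TV by more than half that error.\<close>

lemma crossings_near_TV:
  assumes x: "cadlag x" and c: "c > 0" and t: "0 \<le> t" and R: "\<And>u. u \<in> {0..t} \<Longrightarrow> \<bar>x u\<bar> \<le> R"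
  shows "\<bar>2 * (LINT y|lborel. real (dcross y c x 0 t)) - real_of_ereal (TV c x 0 t)\<bar> \<le> 2 * R + c"
    and "\<bar>2 * real_of_ereal (DTV c x 0 t) - real_of_ereal (TV c x 0 t)\<bar> \<le> 2 * R + c"
proof -
  have R': "\<bar>x 0\<bar> \<le> R" "\<bar>x t\<bar> \<le> R" using R[of 0] R[of t] t by auto
  define J J' where "J = (LINT y|lborel. real (dcross y c x 0 t))"
    and "J' = (LINT y|lborel. real (dcross y c (\<lambda>u. - x u) 0 t))"
  have 1: "2 * J \<le> real_of_ereal (TV c x 0 t) + (2 * R + c)"
    using integral_dcross_le_TV[OF x c t] R' unfolding J_def by auto
  have 2: "2 * J' \<le> real_of_ereal (TV c x 0 t) + (2 * R + c)"
    using integral_dcross_le_TV[OF cadlag_uminus[OF x] c t] R' unfolding J'_def TV_uminus by auto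
  have D: "real_of_ereal (DTV c x 0 t) \<le> J"
    using DTV_le_integral_dcross[OF x c t] TV_finite(2)[OF x c t] unfolding J_def by (metis ereal_less_eq(3))
  have U: "real_of_ereal (UTV c x 0 t) \<le> J'"
    using DTV_le_integral_dcross[OF cadlag_uminus[OF x] c t] TV_finite(3)[OF x c t]
    unfolding J'_def UTV_eq_DTV_uminus by (metis ereal_less_eq(3))
  have "ereal (real_of_ereal (TV c x 0 t)) \<le> ereal (real_of_ereal (UTV c x 0 t) + real_of_ereal (DTV c x 0 t))"
    using TV_le_UTV_DTV[of c x 0 t] c TV_finite[OF x c t] by (metis less_imp_le plus_ereal.simps(1))
  then have 3: "real_of_ereal (TV c x 0 t) \<le> real_of_ereal (UTV c x 0 t) + real_of_ereal (DTV c x 0 t)" by simp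
  show "\<bar>2 * (LINT y|lborel. real (dcross y c x 0 t)) - real_of_ereal (TV c x 0 t)\<bar> \<le> 2 * R + c"
    using 1 2 3 D U unfolding J_def[symmetric] by linarith
  show "\<bar>2 * real_of_ereal (DTV c x 0 t) - real_of_ereal (TV c x 0 t)\<bar> \<le> 2 * R + c"
    using 1 2 3 D U by linarith
qed

section \<open>Lebesgue-Stieltjes integrals of left limits\<close>

lemma left_lim_tendsto:
  assumes "cadlag x" "s > 0"
  shows "(x \<longlongrightarrow> left_lim x s) (at_left s)"
proof -
  obtain l where l: "(x \<longlongrightarrow> l) (at_left s)" using assms by (auto simp: cadlag_def)
  then have "left_lim x s = l" unfolding left_lim_def by (intro tendsto_Lim) auto
  then show ?thesis using l by simp
qed

lemma left_lim_bound:
  assumes x: "cadlag x" and s: "0 \<le> a" "a < s" and e: "\<And>u. u \<in> {a..<s} \<Longrightarrow> \<bar>x u - v\<bar> \<le> e"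
  shows "\<bar>left_lim x s - v\<bar> \<le> e"
proof (rule tendsto_upperbound)
  show "((\<lambda>u. \<bar>x u - v\<bar>) \<longlongrightarrow> \<bar>left_lim x s - v\<bar>) (at_left s)"
    using left_lim_tendsto[OF x, of s] s by (intro tendsto_intros) auto
  show "\<forall>\<^sub>F u in at_left s. \<bar>x u - v\<bar> \<le> e"
    using s e by (intro eventually_at_leftI[of a]) auto
qed simp

text \<open>For \<open>s > 0\<close>, the points \<open>(\<lceil>n s\<rceil> - 1) / n\<close> are non-negative and tend to \<open>s\<close> from the left.\<close>

lemma left_lim_borel_measurable:
  assumes x: "cadlag x"
  shows "(\<lambda>s. indicator {0<..} s * left_lim x s) \<in> borel_measurable borel"
proof (rule borel_measurable_LIMSEQ_real)
  define r where "r n s = (real_of_int \<lceil>real (Suc n) * s\<rceil> - 1) / real (Suc n)" for n s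
  fix s :: real
  show "(\<lambda>n. indicator {0<..} s * x (r n s)) \<longlonglongrightarrow> indicator {0<..} s * left_lim x s"
  proof (cases "s > 0")
    case True
    have less: "r n s < s" for n
      unfolding r_def using of_int_ceiling_le_add_one[of "real (Suc n) * s"] ceiling_correct[of "real (Suc n) * s"]
      by (simp add: divide_less_eq mult.commute)
    have ge: "s - 1 / real (Suc n) \<le> r n s" for n
      unfolding r_def using le_of_int_ceiling[of "real (Suc n) * s"] by (simp add: field_simps del: of_nat_Suc)
    have "(\<lambda>n. r n s) \<longlonglongrightarrow> s"
    proof (rule tendsto_sandwich)
      show "(\<lambda>n. s - 1 / real (Suc n)) \<longlonglongrightarrow> s"
        using tendsto_diff[OF tendsto_const LIMSEQ_inverse_real_of_nat, of s] by (simp add: inverse_eq_divide)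
    qed (use less ge in \<open>auto intro!: always_eventually less_imp_le\<close>)
    then have "filterlim (\<lambda>n. r n s) (at_left s) sequentially"
      using less by (auto simp: filterlim_at intro!: always_eventually less_imp_neq)
    then have "(\<lambda>n. x (r n s)) \<longlonglongrightarrow> left_lim x s"
      using left_lim_tendsto[OF x True] by (rule filterlim_compose[rotated])
    then show ?thesis using True by simp
  qed simp
next
  fix n
  have "(\<lambda>s. x ((real_of_int \<lceil>real (Suc n) * s\<rceil> - 1) / real (Suc n))) \<in> borel_measurable borel"
    by (rule measurable_compose[of "\<lambda>s. \<lceil>real (Suc n) * s\<rceil>" _ "count_space UNIV"]) auto
  then show "(\<lambda>s. indicator {0<..} s * x ((real_of_int \<lceil>real (Suc n) * s\<rceil> - 1) / real (Suc n))) \<in> borel_measurable borel"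
    by (intro borel_measurable_times borel_measurable_indicator) auto
qed

text \<open>The increment is the integral over \<open>{a<..b}\<close>, an interval of measure
  \<open>\<zeta> b - \<zeta> a\<close>, so replacing the integrand by the constant \<open>v\<close>
  costs at most \<open>w\<close> times this measure. The values \<open>v = g (x (\<tau> i))\<close>
  give Riemann-Stieltjes sums, and \<open>v = 0\<close> gives continuity in the upper limit.\<close>

lemma LS_integral_increment:
  fixes g :: "real \<Rightarrow> real"
  assumes x: "cadlag x" and \<zeta>: "cadlag \<zeta>" "mono_on {0..} \<zeta>" and g: "continuous_on UNIV g"
    and ab: "0 \<le> a" "a \<le> b"
    and w: "\<And>s. a < s \<Longrightarrow> s \<le> b \<Longrightarrow> \<bar>g (left_lim x s) - v\<bar> \<le> w"
  shows "\<bar>LS_integral (\<lambda>s. g (left_lim x s)) \<zeta> b - LS_integral (\<lambda>s. g (left_lim x s)) \<zeta> a - v * (\<zeta> b - \<zeta> a)\<bar>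
    \<le> w * (\<zeta> b - \<zeta> a)"
proof -
  define F where "F = (\<lambda>s. \<zeta> (max 0 s))"
  define M where "M = interval_measure F"
  define h where "h s = g (left_lim x s)" for s
  have F_mono: "F s \<le> F u" if "s \<le> u" for s u
    using \<zeta>(2) that unfolding F_def mono_on_def by auto
  have F_cont: "continuous (at_right s) F" for s
  proof (cases "0 \<le> s")
    case True
    have "(\<zeta> \<longlongrightarrow> \<zeta> s) (at_right s)" using \<zeta>(1) True by (auto simp: cadlag_def continuous_within)
    moreover have "\<forall>\<^sub>F u in at_right s. \<zeta> u = F u"
      using True by (intro eventually_at_rightI[of s "s + 1"]) (auto simp: F_def)
    ultimately have "(F \<longlongrightarrow> \<zeta> s) (at_right s)" by (rule Lim_transform_eventually)
    then show ?thesis using True by (simp add: continuous_within F_def)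
  next
    case False
    have "((\<lambda>_. F s) \<longlongrightarrow> F s) (at_right s)" by simp
    moreover have "\<forall>\<^sub>F u in at_right s. F s = F u"
      using False by (intro eventually_at_rightI[of s 0]) (auto simp: F_def)
    ultimately have "(F \<longlongrightarrow> F s) (at_right s)" by (rule Lim_transform_eventually)
    then show ?thesis by (simp add: continuous_within)
  qed
  have em: "emeasure M {s<..u} < \<infinity>" if "s \<le> u" for s u
    unfolding M_def using emeasure_interval_measure_Ioc[OF that F_mono F_cont] by simp
  have me: "measure M {s<..u} = \<zeta> u - \<zeta> s" if "0 \<le> s" "s \<le> u" for s u
    unfolding M_def using measure_interval_measure_Ioc[OF that(2) F_mono F_cont] that by (simp add: F_def)
  have sets: "sets M = sets borel" by (simp add: M_def)
  have int1: "integrable M (\<lambda>s. indicator {c<..d} s :: real)" if "c \<le> d" for c d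
    using em[OF that] by (intro integrable_real_indicator) (auto simp: sets)
  have meas: "(\<lambda>s. indicator {c<..d} s * h s) \<in> borel_measurable M" if "0 \<le> c" for c d
  proof -
    have "g \<in> borel_measurable borel" using g by (rule borel_measurable_continuous_onI)
    \<comment> \<open>Measurability of left limits is known only after cutting off to positive
      times; on \<open>{c<..d}\<close> with \<open>c \<ge> 0\<close> the cut-off changes
      nothing.\<close>
    then have "(\<lambda>s. indicator {c<..d} s * g (indicator {0<..} s * left_lim x s)) \<in> borel_measurable borel"
      by (intro borel_measurable_times borel_measurable_indicator measurable_compose[OF left_lim_borel_measurable[OF x]]) auto
    also have "(\<lambda>s. indicator {c<..d} s * g (indicator {0<..} s * left_lim x s)) = (\<lambda>s. indicator {c<..d} s * h s)"
      using that by (auto simp: h_def indicator_def)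
    finally show ?thesis using measurable_cong_sets[OF sets refl] by blast
  qed
  have bound: "\<exists>G. \<forall>s. c < s \<longrightarrow> s \<le> d \<longrightarrow> \<bar>h s\<bar> \<le> G" if "0 \<le> c" "c \<le> d" for c d
  proof -
    have "0 \<le> d" using that by simp
    then obtain R where R: "R \<ge> 0" "\<And>u. u \<in> {0..d} \<Longrightarrow> \<bar>x u\<bar> \<le> R" using cadlag_bounded[OF x] by blast
    have "compact (g ` {-R..R})"
      by (intro compact_continuous_image continuous_on_subset[OF g]) auto
    then obtain G where G: "\<And>y. y \<in> g ` {-R..R} \<Longrightarrow> norm y \<le> G"
      by (meson bounded_iff compact_imp_bounded)
    have "\<bar>h s\<bar> \<le> G" if "c < s" "s \<le> d" for s
    proof -
      have "\<bar>left_lim x s - 0\<bar> \<le> R" using that \<open>0 \<le> c\<close> R by (intro left_lim_bound[OF x, of c]) auto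
      then have "left_lim x s \<in> {-R..R}" by auto
      then show ?thesis using G[OF imageI] by (simp add: h_def)
    qed
    then show ?thesis by blast
  qed
  have int: "set_integrable M {c<..d} h" if cd: "0 \<le> c" "c \<le> d" for c d
  proof -
    obtain G where G: "\<forall>s. c < s \<longrightarrow> s \<le> d \<longrightarrow> \<bar>h s\<bar> \<le> G" using bound[OF cd] by blast
    have "integrable M (\<lambda>s. indicator {c<..d} s * h s)"
    proof (rule Bochner_Integration.integrable_bound)
      show "integrable M (\<lambda>s. G * indicator {c<..d} s)" using int1[OF cd(2)] by (intro integrable_mult_right)
      show "AE s in M. norm (indicator {c<..d} s * h s) \<le> norm (G * indicator {c<..d} s)"
      proof (rule AE_I2)
        fix s show "norm (indicator {c<..d} s * h s) \<le> norm (G * indicator {c<..d} s)"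
          using G by (cases "s \<in> {c<..d}") (auto intro: order_trans[OF _ abs_ge_self])
      qed
    qed (rule meas[OF cd(1)])
    then show ?thesis by (simp add: set_integrable_def)
  qed
  have LS: "LS_integral (\<lambda>s. g (left_lim x s)) \<zeta> u = (LINT s:{0<..u}|M. h s)" for u
    by (simp add: LS_integral_def M_def F_def h_def)
  have "{0<..b} = {0<..a} \<union> {a<..b}" using ab by auto
  then have "(LINT s:{0<..b}|M. h s) = (LINT s:{0<..a}|M. h s) + (LINT s:{a<..b}|M. h s)"
    using int[of 0 a] int[of a b] ab by (simp add: set_integral_Un)
  then have "LS_integral (\<lambda>s. g (left_lim x s)) \<zeta> b - LS_integral (\<lambda>s. g (left_lim x s)) \<zeta> a = (LINT s|M. indicator {a<..b} s * h s)"
    unfolding LS by (simp add: set_lebesgue_integral_def)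
  moreover have "v * (\<zeta> b - \<zeta> a) = (LINT s|M. v * indicator {a<..b} s)"
    using me[OF ab] int1[OF ab(2)] by (simp add: sets)
  ultimately have "LS_integral (\<lambda>s. g (left_lim x s)) \<zeta> b - LS_integral (\<lambda>s. g (left_lim x s)) \<zeta> a - v * (\<zeta> b - \<zeta> a)
    = (LINT s|M. indicator {a<..b} s * h s - v * indicator {a<..b} s)"
    using int[OF ab] int1[OF ab(2)] by (simp add: set_integrable_def)
  also have "\<bar>\<dots>\<bar> \<le> (LINT s|M. w * indicator {a<..b} s)"
  proof (rule integral_abs_bound_integral)
    show "integrable M (\<lambda>s. indicator {a<..b} s * h s - v * indicator {a<..b} s)"
      using int[OF ab] int1[OF ab(2)] by (intro Bochner_Integration.integrable_diff integrable_mult_right) (auto simp: set_integrable_def)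
    show "integrable M (\<lambda>s. w * indicator {a<..b} s)" using int1[OF ab(2)] by (intro integrable_mult_right)
    fix s show "\<bar>indicator {a<..b} s * h s - v * indicator {a<..b} s\<bar> \<le> w * indicator {a<..b} s"
      using w[of s] by (auto simp: h_def indicator_def)
  qed
  also have "\<dots> = w * (\<zeta> b - \<zeta> a)" using me[OF ab] int1[OF ab(2)] by (simp add: sets)
  finally show ?thesis .
qed

text \<open>It serves both sides of the limit: the Stieltjes integral against \<open>\<zeta>\<close>
  with \<open>k = 0\<close>, and the weighted crossing integrals against the unweighted ones with a
  constant error \<open>k\<close> per interval.\<close>

lemma telescoping_bound:
  fixes A B v :: "nat \<Rightarrow> real"
  assumes "\<And>i. i < m \<Longrightarrow> \<bar>A (Suc i) - A i - v i * (B (Suc i) - B i)\<bar> \<le> w * (B (Suc i) - B i) + k"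
  shows "\<bar>A m - A 0 - (\<Sum>i<m. v i * (B (Suc i) - B i))\<bar> \<le> w * (B m - B 0) + real m * k"
  using assms
proof (induction m)
  case (Suc m)
  have "\<bar>A m - A 0 - (\<Sum>i<m. v i * (B (Suc i) - B i))\<bar> \<le> w * (B m - B 0) + real m * k"
    using Suc by simp
  moreover have "\<bar>A (Suc m) - A m - v m * (B (Suc m) - B m)\<bar> \<le> w * (B (Suc m) - B m) + k"
    using Suc.prems by simp
  ultimately show ?case by (simp add: algebra_simps)
qed simp

section \<open>From pointwise to locally uniform convergence\<close>

text \<open>This is a Polya-type argument: on a short interval the continuous limit is nearly
  constant, and each monotone \<open>f c\<close> is squeezed between its values at the two ends,
  where pointwise convergence applies. Bisection then passes to \<open>{0..b}\<close>.\<close>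

lemma uniform_limit_of_mono:
  fixes f :: "'a \<Rightarrow> real \<Rightarrow> real"
  assumes mono: "\<forall>\<^sub>F c in G. mono_on {0..} (f c)"
    and lim: "\<And>t. 0 \<le> t \<Longrightarrow> ((\<lambda>c. f c t) \<longlongrightarrow> F t) G"
    and cont: "continuous_on {0..} F" and T: "T \<subseteq> {0..b}"
  shows "uniform_limit T f F G"
proof (rule uniform_limit_on_subset[OF _ T], rule uniform_limitI)
  fix e :: real assume e: "e > 0"
  define P where "P u v \<longleftrightarrow> (\<forall>\<^sub>F c in G. \<forall>t. 0 \<le> t \<longrightarrow> u \<le> t \<longrightarrow> t \<le> v \<longrightarrow> dist (f c t) (F t) < e)" for u v
  show "\<forall>\<^sub>F c in G. \<forall>t\<in>{0..b}. dist (f c t) (F t) < e"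
  proof (cases "0 \<le> b")
    case True
    have "P 0 b"
    proof (rule Bolzano[OF True])
      fix u v w assume "P u v" "P v w"
      then show "P u w" unfolding P_def
        by eventually_elim (meson linear)
    next
      fix s assume s: "0 \<le> s" "s \<le> b"
      obtain d where d: "d > 0" "\<And>t. 0 \<le> t \<Longrightarrow> dist t s < d \<Longrightarrow> dist (F t) (F s) < e / 4"
        using cont s e unfolding continuous_on_iff by (metis atLeast_iff divide_pos_pos zero_less_numeral)
      show "\<exists>d>0. \<forall>u v. u \<le> s \<and> s \<le> v \<and> v - u < d \<longrightarrow> P u v"
      proof (intro exI[of _ d] conjI allI impI d(1))
        fix u v assume uv: "u \<le> s \<and> s \<le> v \<and> v - u < d"
        \<comment> \<open>The intervals from the bisection principle may reach below
          \<open>0\<close>, where neither monotonicity nor convergence is assumed.\<close>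
        define u' where "u' = max 0 u"
        have u': "0 \<le> u'" "u' \<le> s" "u \<le> u'" "\<And>t. 0 \<le> t \<Longrightarrow> u \<le> t \<Longrightarrow> u' \<le> t" using uv s by (auto simp: u'_def)
        have Fd: "\<bar>F t - F s\<bar> < e / 4" if "u' \<le> t" "t \<le> v" for t
          using d(2)[of t] that u' uv by (auto simp: dist_real_def)
        have "\<forall>\<^sub>F c in G. dist (f c u') (F u') < e / 4"
          by (rule tendstoD[OF lim]) (use u' e in auto)
        moreover have "\<forall>\<^sub>F c in G. dist (f c v) (F v) < e / 4"
          by (rule tendstoD[OF lim]) (use s uv e in auto)
        ultimately show "P u v" unfolding P_def using mono
        proof eventually_elim
          case (elim c)
          show ?case
          proof (intro allI impI)
            fix t assume t: "0 \<le> t" "u \<le> t" "t \<le> v"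
            have "f c u' \<le> f c t" "f c t \<le> f c v"
              using elim(3) t u' by (auto intro!: mono_onD[of "{0..}" "f c"])
            moreover have "\<bar>F t - F s\<bar> < e / 4" "\<bar>F u' - F s\<bar> < e / 4" "\<bar>F v - F s\<bar> < e / 4"
              using Fd[of t] Fd[of u'] Fd[of v] t u' uv by auto
            ultimately show "dist (f c t) (F t) < e"
              using elim(1,2) unfolding dist_real_def by linarith
          qed
        qed
      qed
    qed
    then show ?thesis unfolding P_def by eventually_elim auto
  qed simp
qed

section \<open>Weighted crossing counts\<close>

text \<open>These are the common properties of \<open>ncross\<close>, \<open>2 * ucross\<close> and
  \<open>2 * dcross\<close>, so that the convergence is proved once for all three. The constant
  \<open>K\<close> bounds the new crossings over a window at levels that the path keeps away from;
  the window is open at \<open>t\<close> so that a jump there is permitted.\<close>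

locale crossing_counts =
  fixes x :: "real \<Rightarrow> real" and N :: "real \<Rightarrow> real \<Rightarrow> real \<Rightarrow> real" and K :: real
  assumes cadlag_path: "cadlag x"
    and N_integrable: "0 < c \<Longrightarrow> 0 \<le> t \<Longrightarrow> integrable lborel (N c t)"
    and N_zero: "0 < c \<Longrightarrow> N c 0 y = 0"
    and N_mono: "0 < c \<Longrightarrow> 0 \<le> s \<Longrightarrow> s \<le> t \<Longrightarrow> N c s y \<le> N c t y"
    and N_support: "0 < c \<Longrightarrow> 0 \<le> t \<Longrightarrow> (\<And>u. u \<in> {0..t} \<Longrightarrow> \<bar>x u\<bar> \<le> R) \<Longrightarrow> N c t y \<noteq> 0 \<Longrightarrow> \<bar>y\<bar> \<le> R"
    and N_local: "0 < c \<Longrightarrow> 0 \<le> s \<Longrightarrow> s \<le> t \<Longrightarrow> (\<And>u. u \<in> {s..<t} \<Longrightarrow> \<bar>x u - x s\<bar> \<le> e) \<Longrightarrow> e < \<bar>y - x s\<bar> \<Longrightarrow>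
      N c t y \<le> N c s y + K"
begin

lemma N_nonneg: "0 < c \<Longrightarrow> 0 \<le> t \<Longrightarrow> 0 \<le> N c t y"
  using N_mono[of c 0 t y] N_zero[of c y] by simp

lemma integrable_mult:
  fixes g :: "real \<Rightarrow> real"
  assumes g: "continuous_on UNIV g" and c: "0 < c" and t: "0 \<le> t"
  shows "integrable lborel (\<lambda>y. N c t y * g y)"
proof -
  obtain R where R: "R \<ge> 0" "\<And>u. u \<in> {0..t} \<Longrightarrow> \<bar>x u\<bar> \<le> R" using cadlag_bounded[OF cadlag_path t] by blast
  have "compact (g ` {-R..R})"
    by (intro compact_continuous_image continuous_on_subset[OF g]) auto
  then obtain G where G: "\<And>y. y \<in> g ` {-R..R} \<Longrightarrow> norm y \<le> G"
    by (meson bounded_iff compact_imp_bounded)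
  show ?thesis
  proof (rule Bochner_Integration.integrable_bound)
    show "integrable lborel (\<lambda>y. G * N c t y)" using N_integrable[OF c t] by (intro integrable_mult_right)
    show "(\<lambda>y. N c t y * g y) \<in> borel_measurable lborel"
      using borel_measurable_integrable[OF N_integrable[OF c t]] borel_measurable_continuous_onI[OF g]
      by (intro borel_measurable_times) auto
    show "AE y in lborel. norm (N c t y * g y) \<le> norm (G * N c t y)"
    proof (rule AE_I2)
      fix y show "norm (N c t y * g y) \<le> norm (G * N c t y)"
      proof (cases "N c t y = 0")
        case False
        then have "\<bar>y\<bar> \<le> R" using N_support[OF c t R(2)] by blast
        then have "y \<in> {-R..R}" by auto
        then have "\<bar>g y\<bar> \<le> G" using G[OF imageI] by simp
        then show ?thesis by (simp add: abs_mult mult.commute[of G] mult_left_mono)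
      qed simp
    qed
  qed
qed

text \<open>For levels within \<open>e\<close> of \<open>x s\<close>, replacing \<open>g y\<close>
  by \<open>g (x s)\<close> costs at most \<open>w\<close> per crossing. For the other levels in
  \<open>{-R..R}\<close> there are at most \<open>K\<close> new crossings, each with error at most
  \<open>2 * G\<close>; this contribution does not depend on \<open>c\<close> and later vanishes
  when multiplied by \<open>\<phi> c\<close>.\<close>

lemma increment_bound:
  fixes g :: "real \<Rightarrow> real"
  assumes g: "continuous_on UNIV g" and c: "0 < c" and st: "0 \<le> s" "s \<le> t" and K: "0 \<le> K"
    and R: "\<And>u. u \<in> {0..t} \<Longrightarrow> \<bar>x u\<bar> \<le> R" "0 \<le> R" and G: "\<And>y. \<bar>y\<bar> \<le> R \<Longrightarrow> \<bar>g y\<bar> \<le> G"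
    and osc: "\<And>u. u \<in> {s..<t} \<Longrightarrow> \<bar>x u - x s\<bar> \<le> e"
    and w: "\<And>y. \<bar>y\<bar> \<le> R \<Longrightarrow> \<bar>y - x s\<bar> \<le> e \<Longrightarrow> \<bar>g y - g (x s)\<bar> \<le> w"
    and w0: "0 \<le> w"
  shows "\<bar>(LINT y|lborel. N c t y * g y) - (LINT y|lborel. N c s y * g y)
      - g (x s) * ((LINT y|lborel. N c t y) - (LINT y|lborel. N c s y))\<bar>
    \<le> w * ((LINT y|lborel. N c t y) - (LINT y|lborel. N c s y)) + K * (2 * G) * (2 * R)"
proof -
  have t: "0 \<le> t" using st by simp
  note int = N_integrable[OF c t] N_integrable[OF c st(1)] integrable_mult[OF g c t] integrable_mult[OF g c st(1)]
  have ind: "integrable lborel (\<lambda>y. indicator {-R..R} y :: real)"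
    using R(2) by (intro integrable_real_indicator) auto
  have diff: "(LINT y|lborel. N c t y * g y) - (LINT y|lborel. N c s y * g y)
      - g (x s) * ((LINT y|lborel. N c t y) - (LINT y|lborel. N c s y))
    = (LINT y|lborel. N c t y * g y - N c s y * g y - g (x s) * (N c t y - N c s y))"
    using int by simp
  have bound: "\<bar>LINT y|lborel. N c t y * g y - N c s y * g y - g (x s) * (N c t y - N c s y)\<bar>
    \<le> (LINT y|lborel. w * (N c t y - N c s y) + K * (2 * G) * indicator {-R..R} y)"
  proof (rule integral_abs_bound_integral)
    show "integrable lborel (\<lambda>y. N c t y * g y - N c s y * g y - g (x s) * (N c t y - N c s y))"
      using int by simp
    show "integrable lborel (\<lambda>y. w * (N c t y - N c s y) + K * (2 * G) * indicator {-R..R} y)"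
      using int ind by (intro Bochner_Integration.integrable_add integrable_mult_right Bochner_Integration.integrable_diff)
    fix y
    define D where "D = N c t y - N c s y"
    have D: "0 \<le> D" using N_mono[OF c st] by (simp add: D_def)
    have eq: "N c t y * g y - N c s y * g y - g (x s) * (N c t y - N c s y) = D * (g y - g (x s))"
      by (simp add: D_def algebra_simps)
    have G0: "0 \<le> G" using G[of 0] R(2) by simp
    have "\<bar>D * (g y - g (x s))\<bar> \<le> w * D + K * (2 * G) * indicator {-R..R} y"
    proof (cases "D = 0")
      case True
      then show ?thesis using K G0 by simp
    next
      case False
      then have "N c t y \<noteq> 0" using N_nonneg[OF c st(1), of y] N_mono[OF c st, of y] by (auto simp: D_def)
      then have y: "\<bar>y\<bar> \<le> R" using N_support[OF c t R(1)] by blast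
      then have "y \<in> {-R..R}" by auto
      then have ind1: "indicator {-R..R} y = (1::real)" by simp
      show ?thesis
      proof (cases "\<bar>y - x s\<bar> \<le> e")
        case True
        have "D * \<bar>g y - g (x s)\<bar> \<le> D * w" using w[OF y True] D by (intro mult_left_mono)
        moreover have "0 \<le> K * (2 * G)" using K G0 by simp
        ultimately have "D * \<bar>g y - g (x s)\<bar> \<le> w * D + K * (2 * G)" by (simp only: mult.commute[of w])
        then show ?thesis using D ind1 by (simp add: abs_mult)
      next
        case False
        then have "D \<le> K" using N_local[OF c st osc, of y] by (simp add: D_def)
        moreover have "\<bar>g y - g (x s)\<bar> \<le> 2 * G" using G[OF y] G[of "x s"] R(1)[of s] st by auto
        ultimately have "D * \<bar>g y - g (x s)\<bar> \<le> K * (2 * G)" using D K by (intro mult_mono) auto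
        moreover have "0 \<le> w * D" using w0 D by simp
        ultimately show ?thesis using D ind1 by (simp add: abs_mult)
      qed
    qed
    then show "\<bar>N c t y * g y - N c s y * g y - g (x s) * (N c t y - N c s y)\<bar> \<le> w * (N c t y - N c s y) + K * (2 * G) * indicator {-R..R} y"
      unfolding eq by (simp add: D_def)
  qed
  have "(LINT y|lborel. w * (N c t y - N c s y) + K * (2 * G) * indicator {-R..R} y)
    = (LINT y|lborel. w * (N c t y - N c s y)) + (LINT y|lborel. K * (2 * G) * indicator {-R..R} y)"
    using int ind by (intro Bochner_Integration.integral_add integrable_mult_right Bochner_Integration.integrable_diff)
  also have "(LINT y|lborel. w * (N c t y - N c s y)) = w * ((LINT y|lborel. N c t y) - (LINT y|lborel. N c s y))"
    using int(1,2) by simp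
  also have "(LINT y|lborel. K * (2 * G) * indicator {-R..R} y) = K * (2 * G) * (2 * R)"
    using R(2) by simp
  finally show ?thesis using bound unfolding diff by simp
qed

text \<open>One fixed partition serves both sides: the weighted crossing integral and the Stieltjes
  integral are compared with sums having the same weights \<open>g (x (\<tau> i))\<close>, and these
  finite sums converge to each other because the unweighted integrals converge at each
  \<open>\<tau> i\<close>.\<close>

lemma tendsto_LS_integral:
  fixes g :: "real \<Rightarrow> real"
  assumes K: "0 \<le> K"
    and \<zeta>: "cadlag \<zeta>" "mono_on {0..} \<zeta>" "\<zeta> 0 = 0"
    and \<phi>: "\<And>c. c > 0 \<Longrightarrow> \<phi> c \<ge> 0" "(\<phi> \<longlongrightarrow> 0) (at_right 0)"
    and lim: "\<And>t. 0 \<le> t \<Longrightarrow> ((\<lambda>c. \<phi> c * (LINT y|lborel. N c t y)) \<longlongrightarrow> \<zeta> t) (at_right 0)"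
    and g: "continuous_on UNIV g" and t: "0 \<le> t"
  shows "((\<lambda>c. \<phi> c * (LINT y|lborel. N c t y * g y)) \<longlongrightarrow> LS_integral (\<lambda>s. g (left_lim x s)) \<zeta> t) (at_right 0)"
proof (rule tendstoI)
  fix \<delta> :: real assume \<delta>: "0 < \<delta>"
  define LS where "LS = LS_integral (\<lambda>s. g (left_lim x s)) \<zeta>"
  define J JG where "J c s = (LINT y|lborel. N c s y)" and "JG c s = (LINT y|lborel. N c s y * g y)" for c s
  have LS0: "LS 0 = 0" by (simp add: LS_def LS_integral_def set_lebesgue_integral_def)
  have J0: "J c 0 = 0" "JG c 0 = 0" if "0 < c" for c using N_zero[OF that] by (simp_all add: J_def JG_def)
  have \<zeta>t: "0 \<le> \<zeta> t" using mono_onD[OF \<zeta>(2), of 0 t] t \<zeta>(3) by auto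
  \<comment> \<open>Each side contributes an error close to \<open>w * \<zeta> t\<close>, and the
    two must stay below \<open>\<delta>\<close>; the summand \<open>1\<close> covers the case
    \<open>\<zeta> t = 0\<close>.\<close>
  define w where "w = \<delta> / (2 * \<zeta> t + 1)"
  have w: "0 < w" "w * \<zeta> t + w * \<zeta> t < \<delta>"
  proof -
    show "0 < w" using \<delta> \<zeta>t by (simp add: w_def)
    moreover have "w * (2 * \<zeta> t + 1) = \<delta>" using \<zeta>t by (simp add: w_def)
    ultimately show "w * \<zeta> t + w * \<zeta> t < \<delta>" by (simp add: algebra_simps)
  qed
  obtain R where R: "R \<ge> 0" "\<And>u. u \<in> {0..t} \<Longrightarrow> \<bar>x u\<bar> \<le> R" using cadlag_bounded[OF cadlag_path t] by blast
  have cpt: "compact {-R..R}" "continuous_on {-R..R} g" using continuous_on_subset[OF g] by auto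
  have "uniformly_continuous_on {-R..R} g" using compact_uniformly_continuous cpt by blast
  then obtain d where d: "0 < d" "\<And>y y'. y \<in> {-R..R} \<Longrightarrow> y' \<in> {-R..R} \<Longrightarrow> dist y' y < d \<Longrightarrow> dist (g y') (g y) < w"
    using w(1) unfolding uniformly_continuous_on_def by meson
  define e where "e = d / 2"
  have e0: "0 < e" using d by (simp add: e_def)
  have e: "\<bar>g y' - g y\<bar> \<le> w" if "\<bar>y\<bar> \<le> R" "\<bar>y'\<bar> \<le> R" "\<bar>y' - y\<bar> \<le> e" for y y'
  proof -
    have "y \<in> {-R..R}" "y' \<in> {-R..R}" "dist y' y < d" using that d(1) by (auto simp: e_def dist_real_def)
    from d(2)[OF this] show "\<bar>g y' - g y\<bar> \<le> w" by (simp add: dist_real_def)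
  qed
  have "compact (g ` {-R..R})" by (rule compact_continuous_image[OF cpt(2,1)])
  then obtain G where "\<And>y. y \<in> g ` {-R..R} \<Longrightarrow> norm y \<le> G"
    by (meson bounded_iff compact_imp_bounded)
  then have G: "\<bar>g y\<bar> \<le> G" if "\<bar>y\<bar> \<le> R" for y using that by (force simp: abs_le_iff)
  obtain \<tau> :: "nat \<Rightarrow> real" and m where \<tau>: "\<tau> 0 = 0" "\<tau> m = t" "\<And>i j. i < j \<Longrightarrow> j \<le> m \<Longrightarrow> \<tau> i < \<tau> j"
    "\<And>i u v. i < m \<Longrightarrow> u \<in> {\<tau> i..<\<tau> (Suc i)} \<Longrightarrow> v \<in> {\<tau> i..<\<tau> (Suc i)} \<Longrightarrow> \<bar>x u - x v\<bar> \<le> e"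
    using cadlag_partition[OF cadlag_path t e0] by metis
  have \<tau>_range: "0 \<le> \<tau> i" "\<tau> i \<le> t" if "i \<le> m" for i
    using \<tau>(3)[of 0 i] \<tau>(3)[of i m] that \<tau>(1,2) by (cases "i = 0"; cases "i = m"; force)+
  have \<tau>_step: "0 \<le> \<tau> i" "\<tau> i < \<tau> (Suc i)" "\<tau> (Suc i) \<le> t" if "i < m" for i
    using \<tau>_range[of i] \<tau>_range[of "Suc i"] \<tau>(3)[of i "Suc i"] that by auto
  have osc: "\<bar>x u - x (\<tau> i)\<bar> \<le> e" if "i < m" "u \<in> {\<tau> i..<\<tau> (Suc i)}" for i u
    using \<tau>(4)[of i u "\<tau> i"] that \<tau>_step[of i] by auto
  define v where "v i = g (x (\<tau> i))" for i
  have LS_bound: "\<bar>LS t - (\<Sum>i<m. v i * (\<zeta> (\<tau> (Suc i)) - \<zeta> (\<tau> i)))\<bar> \<le> w * \<zeta> t"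
  proof -
    have "\<bar>LS (\<tau> m) - LS (\<tau> 0) - (\<Sum>i<m. v i * (\<zeta> (\<tau> (Suc i)) - \<zeta> (\<tau> i)))\<bar> \<le> w * (\<zeta> (\<tau> m) - \<zeta> (\<tau> 0)) + real m * 0"
    proof (rule telescoping_bound)
      fix i assume i: "i < m"
      have "\<bar>LS (\<tau> (Suc i)) - LS (\<tau> i) - v i * (\<zeta> (\<tau> (Suc i)) - \<zeta> (\<tau> i))\<bar> \<le> w * (\<zeta> (\<tau> (Suc i)) - \<zeta> (\<tau> i))"
        unfolding LS_def
      proof (rule LS_integral_increment[OF cadlag_path \<zeta>(1,2) g])
        fix s assume s: "\<tau> i < s" "s \<le> \<tau> (Suc i)"
        have "\<bar>left_lim x s - x (\<tau> i)\<bar> \<le> e"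
          using osc[OF i] s \<tau>_step[OF i] by (intro left_lim_bound[OF cadlag_path, of "\<tau> i"]) auto
        moreover have "\<bar>left_lim x s - 0\<bar> \<le> R"
          using R(2) s \<tau>_step[OF i] by (intro left_lim_bound[OF cadlag_path, of "\<tau> i"]) auto
        ultimately show "\<bar>g (left_lim x s) - v i\<bar> \<le> w"
          using e[of "x (\<tau> i)" "left_lim x s"] R(2)[of "\<tau> i"] \<tau>_step[OF i] by (simp add: v_def)
      qed (use \<tau>_step[OF i] in auto)
      then show "\<bar>LS (\<tau> (Suc i)) - LS (\<tau> i) - v i * (\<zeta> (\<tau> (Suc i)) - \<zeta> (\<tau> i))\<bar> \<le> w * (\<zeta> (\<tau> (Suc i)) - \<zeta> (\<tau> i)) + 0"
        by simp
    qed
    then show ?thesis using \<tau>(1,2) LS0 \<zeta>(3) by simp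
  qed
  define k where "k = K * (2 * G) * (2 * R)"
  have JG_bound: "\<bar>JG c t - (\<Sum>i<m. v i * (J c (\<tau> (Suc i)) - J c (\<tau> i)))\<bar> \<le> w * J c t + real m * k" if c: "0 < c" for c
  proof -
    have "\<bar>JG c (\<tau> m) - JG c (\<tau> 0) - (\<Sum>i<m. v i * (J c (\<tau> (Suc i)) - J c (\<tau> i)))\<bar> \<le> w * (J c (\<tau> m) - J c (\<tau> 0)) + real m * k"
    proof (rule telescoping_bound)
      fix i assume i: "i < m"
      show "\<bar>JG c (\<tau> (Suc i)) - JG c (\<tau> i) - v i * (J c (\<tau> (Suc i)) - J c (\<tau> i))\<bar> \<le> w * (J c (\<tau> (Suc i)) - J c (\<tau> i)) + k"
        unfolding JG_def J_def v_def k_def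
      proof (rule increment_bound[OF g c _ _ K])
        show "0 \<le> \<tau> i" "\<tau> i \<le> \<tau> (Suc i)" using \<tau>_step[OF i] by auto
        show "\<bar>x u\<bar> \<le> R" if "u \<in> {0..\<tau> (Suc i)}" for u using R(2)[of u] that \<tau>_step[OF i] by auto
        show "0 \<le> R" by fact
        show "\<bar>g y\<bar> \<le> G" if "\<bar>y\<bar> \<le> R" for y using G[OF that] .
        show "\<bar>x u - x (\<tau> i)\<bar> \<le> e" if "u \<in> {\<tau> i..<\<tau> (Suc i)}" for u using osc[OF i that] .
        show "\<bar>g y - g (x (\<tau> i))\<bar> \<le> w" if "\<bar>y\<bar> \<le> R" "\<bar>y - x (\<tau> i)\<bar> \<le> e" for y
          using e[of "x (\<tau> i)" y] R(2)[of "\<tau> i"] \<tau>_step[OF i] that by auto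
        show "0 \<le> w" using w by simp
      qed
    qed
    then show ?thesis using \<tau>(1,2) J0[OF c] by simp
  qed
  \<comment> \<open>The total error: variation of \<open>g\<close> on the crossing side, levels far
    from the path, difference of the two finite sums, and variation of \<open>g\<close> on the
    Stieltjes side.\<close>
  let ?B = "\<lambda>c. w * (\<phi> c * J c t) + \<phi> c * (real m * k)
    + \<bar>\<Sum>i<m. v i * ((\<phi> c * J c (\<tau> (Suc i)) - \<phi> c * J c (\<tau> i)) - (\<zeta> (\<tau> (Suc i)) - \<zeta> (\<tau> i)))\<bar> + w * \<zeta> t"
  have limJ: "((\<lambda>c. \<phi> c * J c s) \<longlongrightarrow> \<zeta> s) (at_right 0)" if "0 \<le> s" for s
    using lim[OF that] by (simp add: J_def)
  have "(?B \<longlongrightarrow> w * \<zeta> t + 0 * (real m * k)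
    + \<bar>\<Sum>i<m. v i * ((\<zeta> (\<tau> (Suc i)) - \<zeta> (\<tau> i)) - (\<zeta> (\<tau> (Suc i)) - \<zeta> (\<tau> i)))\<bar> + w * \<zeta> t) (at_right 0)"
    using \<tau>_range by (intro tendsto_intros limJ \<phi>(2) t) auto
  then have "(?B \<longlongrightarrow> w * \<zeta> t + w * \<zeta> t) (at_right 0)" by simp
  then have "\<forall>\<^sub>F c in at_right 0. ?B c < \<delta>" using w(2) by (rule order_tendstoD)
  moreover have "\<forall>\<^sub>F c in at_right (0::real). 0 < c" by (rule eventually_at_right_less)
  ultimately have "\<forall>\<^sub>F c in at_right 0. dist (\<phi> c * JG c t) (LS t) < \<delta>"
  proof eventually_elim
    case (elim c)
    define S where "S = (\<Sum>i<m. v i * (J c (\<tau> (Suc i)) - J c (\<tau> i)))"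
    define Z where "Z = (\<Sum>i<m. v i * (\<zeta> (\<tau> (Suc i)) - \<zeta> (\<tau> i)))"
    have "\<bar>\<phi> c * JG c t - \<phi> c * S\<bar> = \<phi> c * \<bar>JG c t - S\<bar>"
      using \<phi>(1)[OF elim(2)] by (simp add: right_diff_distrib[symmetric] abs_mult)
    also have "\<dots> \<le> \<phi> c * (w * J c t + real m * k)"
      using JG_bound[OF elim(2)] \<phi>(1)[OF elim(2)] unfolding S_def by (intro mult_left_mono)
    finally have 1: "\<bar>\<phi> c * JG c t - \<phi> c * S\<bar> \<le> w * (\<phi> c * J c t) + \<phi> c * (real m * k)"
      by (simp add: algebra_simps)
    have 2: "\<phi> c * S - Z = (\<Sum>i<m. v i * ((\<phi> c * J c (\<tau> (Suc i)) - \<phi> c * J c (\<tau> i)) - (\<zeta> (\<tau> (Suc i)) - \<zeta> (\<tau> i))))"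
      unfolding S_def Z_def sum_distrib_left sum_subtractf[symmetric] by (intro sum.cong) (auto simp: algebra_simps)
    have 3: "\<bar>LS t - Z\<bar> \<le> w * \<zeta> t" using LS_bound by (simp add: Z_def)
    show ?case using 1 3 elim(1) unfolding 2[symmetric] dist_real_def by linarith
  qed
  then show "\<forall>\<^sub>F c in at_right 0. dist (\<phi> c * (LINT y|lborel. N c t y * g y)) (LS_integral (\<lambda>s. g (left_lim x s)) \<zeta> t) < \<delta>"
    by (simp add: JG_def LS_def)
qed

text \<open>With \<open>g\<close> bounded by \<open>G\<close> on the range of left limits,
  increments of the integral are at most \<open>G\<close> times increments of
  \<open>\<zeta>\<close>.\<close>

lemma LS_integral_continuous_on:
  fixes g :: "real \<Rightarrow> real"
  assumes \<zeta>: "cadlag \<zeta>" "mono_on {0..} \<zeta>" "continuous_on {0..} \<zeta>" and g: "continuous_on UNIV g"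
  shows "continuous_on {0..} (LS_integral (\<lambda>s. g (left_lim x s)) \<zeta>)"
proof -
  let ?LS = "LS_integral (\<lambda>s. g (left_lim x s)) \<zeta>"
  have "continuous (at t within {0..}) ?LS" if t: "t \<in> {0..}" for t
  proof -
    have t1: "0 \<le> t + 1" using t by simp
    obtain R where R: "R \<ge> 0" "\<And>u. u \<in> {0..t + 1} \<Longrightarrow> \<bar>x u\<bar> \<le> R" using cadlag_bounded[OF cadlag_path t1] by blast
    have "compact (g ` {-R..R})" by (intro compact_continuous_image continuous_on_subset[OF g]) auto
    then obtain G where G: "\<And>y. y \<in> g ` {-R..R} \<Longrightarrow> norm y \<le> G"
      by (meson bounded_iff compact_imp_bounded)
    have incr: "\<bar>?LS b - ?LS a\<bar> \<le> G * (\<zeta> b - \<zeta> a)" if ab: "0 \<le> a" "a \<le> b" "b \<le> t + 1" for a b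
    proof -
      have "\<bar>?LS b - ?LS a - 0 * (\<zeta> b - \<zeta> a)\<bar> \<le> G * (\<zeta> b - \<zeta> a)"
      proof (rule LS_integral_increment[OF cadlag_path \<zeta>(1,2) g ab(1,2)])
        fix s assume s: "a < s" "s \<le> b"
        have "\<bar>left_lim x s - 0\<bar> \<le> R" using R(2) s ab by (intro left_lim_bound[OF cadlag_path, of a]) auto
        then have "left_lim x s \<in> {-R..R}" by auto
        then show "\<bar>g (left_lim x s) - 0\<bar> \<le> G" using G[OF imageI] by simp
      qed
      then show ?thesis by simp
    qed
    have "((\<lambda>s. G * \<bar>\<zeta> s - \<zeta> t\<bar>) \<longlongrightarrow> G * \<bar>\<zeta> t - \<zeta> t\<bar>) (at t within {0..})"
      using \<zeta>(3) t by (intro tendsto_intros) (auto simp: continuous_on_def)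
    then have lim0: "((\<lambda>s. G * \<bar>\<zeta> s - \<zeta> t\<bar>) \<longlongrightarrow> 0) (at t within {0..})" by simp
    have "((\<lambda>s. ?LS s - ?LS t) \<longlongrightarrow> 0) (at t within {0..})"
    proof (rule Lim_null_comparison[OF _ lim0])
      show "\<forall>\<^sub>F s in at t within {0..}. norm (?LS s - ?LS t) \<le> G * \<bar>\<zeta> s - \<zeta> t\<bar>"
        unfolding eventually_at
      proof (intro exI[of _ 1] conjI ballI impI)
        fix s assume s: "s \<in> {0..}" "s \<noteq> t \<and> dist s t < 1"
        show "norm (?LS s - ?LS t) \<le> G * \<bar>\<zeta> s - \<zeta> t\<bar>"
        proof (cases "s \<le> t")
          case True
          then show ?thesis using incr[of s t] s mono_onD[OF \<zeta>(2), of s t] t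
            by (simp add: abs_minus_commute)
        next
          case False
          then show ?thesis using incr[of t s] s mono_onD[OF \<zeta>(2), of t s] t
            by (simp add: dist_real_def)
        qed
      qed simp
    qed
    then show ?thesis unfolding continuous_within by (simp add: LIM_zero_iff)
  qed
  then show ?thesis by (simp add: continuous_on_eq_continuous_within)
qed

text \<open>Weighted integrals are monotone in \<open>t\<close> only for non-negative weights, so
  \<open>g\<close> is split into its positive and negative parts.\<close>

lemma uniform_limit_LS_integral:
  fixes g :: "real \<Rightarrow> real"
  assumes K: "0 \<le> K"
    and \<zeta>: "cadlag \<zeta>" "mono_on {0..} \<zeta>" "\<zeta> 0 = 0" "continuous_on {0..} \<zeta>"
    and \<phi>: "\<And>c. c > 0 \<Longrightarrow> \<phi> c \<ge> 0" "(\<phi> \<longlongrightarrow> 0) (at_right 0)"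
    and lim: "\<And>t. 0 \<le> t \<Longrightarrow> ((\<lambda>c. \<phi> c * (LINT y|lborel. N c t y)) \<longlongrightarrow> \<zeta> t) (at_right 0)"
    and g: "continuous_on UNIV g" and T: "T \<subseteq> {0..b}"
  shows "uniform_limit T (\<lambda>c t. \<phi> c * (LINT y|lborel. N c t y * g y)) (LS_integral (\<lambda>s. g (left_lim x s)) \<zeta>) (at_right 0)"
proof -
  define gp gm where "gp = (\<lambda>y. max (g y) 0)" and "gm = (\<lambda>y. max (- g y) 0)"
  have cont: "continuous_on UNIV gp" "continuous_on UNIV gm"
    unfolding gp_def gm_def using g by (intro continuous_intros; simp)+
  have pos: "0 \<le> gp y" "0 \<le> gm y" for y by (auto simp: gp_def gm_def)
  have ev: "\<forall>\<^sub>F c in at_right (0::real). 0 < c" by (rule eventually_at_right_less)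
  have unif: "uniform_limit T (\<lambda>c t. \<phi> c * (LINT y|lborel. N c t y * h y)) (LS_integral (\<lambda>s. h (left_lim x s)) \<zeta>) (at_right 0)"
    if h: "continuous_on UNIV h" "\<And>y. 0 \<le> h y" for h
  proof (rule uniform_limit_of_mono[OF _ _ _ T])
    show "\<forall>\<^sub>F c in at_right 0. mono_on {0..} (\<lambda>t. \<phi> c * (LINT y|lborel. N c t y * h y))"
      using ev
    proof eventually_elim
      case (elim c)
      show ?case
      proof (rule mono_onI)
        fix s t :: real assume st: "s \<in> {0..}" "t \<in> {0..}" "s \<le> t"
        have "(LINT y|lborel. N c s y * h y) \<le> (LINT y|lborel. N c t y * h y)"
          using st elim h(2) by (intro integral_mono integrable_mult[OF h(1)] mult_right_mono N_mono) auto
        then show "\<phi> c * (LINT y|lborel. N c s y * h y) \<le> \<phi> c * (LINT y|lborel. N c t y * h y)"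
          using \<phi>(1)[OF elim] by (rule mult_left_mono)
      qed
    qed
    show "((\<lambda>c. \<phi> c * (LINT y|lborel. N c t y * h y)) \<longlongrightarrow> LS_integral (\<lambda>s. h (left_lim x s)) \<zeta> t) (at_right 0)"
      if "0 \<le> t" for t using tendsto_LS_integral[OF K \<zeta>(1-3) \<phi> lim h(1) that] by simp
    show "continuous_on {0..} (LS_integral (\<lambda>s. h (left_lim x s)) \<zeta>)"
      using LS_integral_continuous_on[OF \<zeta>(1,2,4) h(1)] .
  qed
  have eq: "\<phi> c * (LINT y|lborel. N c t y * gp y) - \<phi> c * (LINT y|lborel. N c t y * gm y) = \<phi> c * (LINT y|lborel. N c t y * g y)"
    if "0 < c" "0 \<le> t" for c t
  proof -
    have "(LINT y|lborel. N c t y * gp y) - (LINT y|lborel. N c t y * gm y) = (LINT y|lborel. N c t y * gp y - N c t y * gm y)"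
      using integrable_mult[OF cont(1) that] integrable_mult[OF cont(2) that] by simp
    also have "\<dots> = (LINT y|lborel. N c t y * g y)"
      by (intro Bochner_Integration.integral_cong) (auto simp: gp_def gm_def max_def)
    finally show ?thesis by (simp add: right_diff_distrib[symmetric])
  qed
  have "uniform_limit T (\<lambda>c t. \<phi> c * (LINT y|lborel. N c t y * gp y) - \<phi> c * (LINT y|lborel. N c t y * gm y))
    (\<lambda>t. LS_integral (\<lambda>s. gp (left_lim x s)) \<zeta> t - LS_integral (\<lambda>s. gm (left_lim x s)) \<zeta> t) (at_right 0)"
    by (intro uniform_limit_intros unif cont pos)
  \<comment> \<open>Additivity of the Stieltjes integral is inherited from the crossing integrals by
    uniqueness of limits.\<close>
  moreover have "LS_integral (\<lambda>s. gp (left_lim x s)) \<zeta> t - LS_integral (\<lambda>s. gm (left_lim x s)) \<zeta> t = LS_integral (\<lambda>s. g (left_lim x s)) \<zeta> t"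
    if t: "0 \<le> t" for t
  proof (rule tendsto_unique)
    have conv: "((\<lambda>c. \<phi> c * (LINT y|lborel. N c t y * h y)) \<longlongrightarrow> LS_integral (\<lambda>s. h (left_lim x s)) \<zeta> t) (at_right 0)"
      if "continuous_on UNIV h" for h using tendsto_LS_integral[OF K \<zeta>(1-3) \<phi> lim that t] by simp
    show "((\<lambda>c. \<phi> c * (LINT y|lborel. N c t y * g y)) \<longlongrightarrow> LS_integral (\<lambda>s. g (left_lim x s)) \<zeta> t) (at_right 0)"
      by (rule conv[OF g])
    show "((\<lambda>c. \<phi> c * (LINT y|lborel. N c t y * g y)) \<longlongrightarrow>
      LS_integral (\<lambda>s. gp (left_lim x s)) \<zeta> t - LS_integral (\<lambda>s. gm (left_lim x s)) \<zeta> t) (at_right 0)"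
      by (rule Lim_transform_eventually[OF tendsto_diff[OF conv[OF cont(1)] conv[OF cont(2)]]])
        (use ev in \<open>auto elim!: eventually_mono intro!: eq t\<close>)
  qed simp
  ultimately show ?thesis
    using ev T by (subst (asm) uniform_limit_cong) (auto elim!: eventually_mono intro!: eq)
qed

end

section \<open>Down-, up- and total crossing numbers as instances\<close>

lemma crossing_counts_dcross:
  assumes x: "cadlag x"
  shows "crossing_counts x (\<lambda>c t y. real (dcross y c x 0 t)) 1"
proof
  fix c s t y R e :: real
  assume c: "0 < c"
  show "integrable lborel (\<lambda>y. real (dcross y c x 0 t))" if "0 \<le> t" using dcross_integrable[OF x c that] .
  have "dcross y c x 0 0 = 0"
  proof (rule ccontr)
    assume "dcross y c x 0 0 \<noteq> 0"
    then have "Suc 0 \<le> dcross y c x 0 0" by simp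
    then show False using le_dcross_iff[OF x c, of 0 "Suc 0" y] by auto
  qed
  then show "real (dcross y c x 0 0) = 0" by simp
  show "real (dcross y c x 0 s) \<le> real (dcross y c x 0 t)" if "0 \<le> s" "s \<le> t"
    using dcross_mono[OF x c that] by simp
  show "\<bar>y\<bar> \<le> R" if "0 \<le> t" "\<And>u. u \<in> {0..t} \<Longrightarrow> \<bar>x u\<bar> \<le> R" "real (dcross y c x 0 t) \<noteq> 0"
    using dcross_support[OF x c that(1,2), of y] that(3) by simp
  show "real (dcross y c x 0 t) \<le> real (dcross y c x 0 s) + 1"
    if "0 \<le> s" "s \<le> t" "\<And>u. u \<in> {s..<t} \<Longrightarrow> \<bar>x u - x s\<bar> \<le> e" "e < \<bar>y - x s\<bar>"
    using dcross_local[OF x c that] by simp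
qed (rule x)

lemma crossing_counts_reflect:
  assumes "crossing_counts (\<lambda>u. - x u) N K"
  shows "crossing_counts x (\<lambda>c t y. N c t (- y)) K"
proof -
  interpret crossing_counts "\<lambda>u. - x u" N K by fact
  show ?thesis
  proof
    show "cadlag x" using cadlag_uminus[OF cadlag_path] by simp
    fix c s t y R e :: real
    assume c: "0 < c"
    show "integrable lborel (\<lambda>y. N c t (- y))" if "0 \<le> t"
      using lborel_integrable_real_affine[OF N_integrable[OF c that], of "-1" 0] by simp
    show "N c 0 (- y) = 0" using N_zero[OF c] .
    show "N c s (- y) \<le> N c t (- y)" if "0 \<le> s" "s \<le> t" using N_mono[OF c that] .
    show "\<bar>y\<bar> \<le> R" if "0 \<le> t" "\<And>u. u \<in> {0..t} \<Longrightarrow> \<bar>x u\<bar> \<le> R" "N c t (- y) \<noteq> 0"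
      using N_support[OF c that(1), of R "- y"] that(2,3) by simp
    show "N c t (- y) \<le> N c s (- y) + K"
      if "0 \<le> s" "s \<le> t" "\<And>u. u \<in> {s..<t} \<Longrightarrow> \<bar>x u - x s\<bar> \<le> e" "e < \<bar>y - x s\<bar>"
      using that(3,4) by (intro N_local[OF c that(1,2), of e]) (auto simp: abs_minus_commute)
  qed
qed

text \<open>Adding upcrossings and downcrossings gives \<open>ncross\<close>; adding a count to
  itself gives the doubled counts.\<close>

lemma crossing_counts_add:
  assumes "crossing_counts x N K" "crossing_counts x N' K'"
  shows "crossing_counts x (\<lambda>c t y. N c t y + N' c t y) (K + K')"
proof -
  interpret A: crossing_counts x N K by fact
  interpret B: crossing_counts x N' K' by fact
  show ?thesis
  proof
    show "cadlag x" by (rule A.cadlag_path)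
    fix c s t y R e :: real
    assume c: "0 < c"
    show "integrable lborel (\<lambda>y. N c t y + N' c t y)" if "0 \<le> t"
      using A.N_integrable[OF c that] B.N_integrable[OF c that] by simp
    show "N c 0 y + N' c 0 y = 0" using A.N_zero[OF c] B.N_zero[OF c] by simp
    show "N c s y + N' c s y \<le> N c t y + N' c t y" if "0 \<le> s" "s \<le> t"
      using A.N_mono[OF c that] B.N_mono[OF c that] by (rule add_mono)
    show "\<bar>y\<bar> \<le> R" if "0 \<le> t" "\<And>u. u \<in> {0..t} \<Longrightarrow> \<bar>x u\<bar> \<le> R" "N c t y + N' c t y \<noteq> 0"
      using A.N_support[OF c that(1,2), of y] B.N_support[OF c that(1,2), of y] that(3) by fastforce
    show "N c t y + N' c t y \<le> N c s y + N' c s y + (K + K')"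
      if "0 \<le> s" "s \<le> t" "\<And>u. u \<in> {s..<t} \<Longrightarrow> \<bar>x u - x s\<bar> \<le> e" "e < \<bar>y - x s\<bar>"
      using add_mono[OF A.N_local[OF c that] B.N_local[OF c that]] by simp
  qed
qed

lemma crossing_counts_ucross:
  assumes x: "cadlag x"
  shows "crossing_counts x (\<lambda>c t y. real (ucross y c x 0 t)) 1"
  using crossing_counts_reflect[OF crossing_counts_dcross[OF cadlag_uminus[OF x]]]
  by (simp add: ucross_def)

lemma integral_ucross:
  "(LINT y|lborel. real (ucross y c x 0 t)) = (LINT y|lborel. real (dcross y c (\<lambda>u. - x u) 0 t))"
  using lborel_integral_real_affine[of "-1" "\<lambda>y. real (dcross y c (\<lambda>u. - x u) 0 t)" 0]
  by (simp add: ucross_def)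

lemma UTV_near_TV:
  assumes x: "cadlag x" and c: "c > 0" and t: "0 \<le> t" and R: "\<And>u. u \<in> {0..t} \<Longrightarrow> \<bar>x u\<bar> \<le> R"
  shows "\<bar>2 * (LINT y|lborel. real (ucross y c x 0 t)) - real_of_ereal (TV c x 0 t)\<bar> \<le> 2 * R + c"
    and "\<bar>2 * real_of_ereal (UTV c x 0 t) - real_of_ereal (TV c x 0 t)\<bar> \<le> 2 * R + c"
  using crossings_near_TV[OF cadlag_uminus[OF x] c t, of R] R
  unfolding TV_uminus UTV_eq_DTV_uminus integral_ucross by auto

section \<open>Transfer of limits and equivalence of the three conditions\<close>

lemma tendsto_transfer_bounded:
  fixes A B \<phi> :: "real \<Rightarrow> real"
  assumes \<phi>: "\<And>c. c > 0 \<Longrightarrow> \<phi> c \<ge> 0" "(\<phi> \<longlongrightarrow> 0) (at_right 0)"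
    and AB: "\<And>c. 0 < c \<Longrightarrow> \<bar>A c - B c\<bar> \<le> k + c"
    and A: "((\<lambda>c. \<phi> c * A c) \<longlongrightarrow> l) (at_right 0)"
  shows "((\<lambda>c. \<phi> c * B c) \<longlongrightarrow> l) (at_right 0)"
proof (rule Lim_transform[OF A])
  have "((\<lambda>c. \<phi> c * (k + c)) \<longlongrightarrow> 0 * (k + 0)) (at_right 0)"
    by (intro tendsto_intros \<phi>(2))
  then have lim: "((\<lambda>c. \<phi> c * (k + c)) \<longlongrightarrow> 0) (at_right 0)" by simp
  show "((\<lambda>c. \<phi> c * B c - \<phi> c * A c) \<longlongrightarrow> 0) (at_right 0)"
  proof (rule Lim_null_comparison[OF _ lim], rule eventually_at_rightI[of 0 1])
    fix c :: real assume "c \<in> {0<..<1}"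
    then have c: "0 < c" by simp
    have "norm (\<phi> c * B c - \<phi> c * A c) = \<phi> c * \<bar>A c - B c\<bar>"
      using \<phi>(1)[OF c] by (simp add: right_diff_distrib[symmetric] abs_mult abs_minus_commute)
    also have "\<dots> \<le> \<phi> c * (k + c)" using AB[OF c] \<phi>(1)[OF c] by (rule mult_left_mono)
    finally show "norm (\<phi> c * B c - \<phi> c * A c) \<le> \<phi> c * (k + c)" .
  qed simp
qed

lemma ereal_tendsto_iff_real:
  fixes V :: "real \<Rightarrow> ereal"
  assumes "\<And>c. 0 < c \<Longrightarrow> V c = ereal (real_of_ereal (V c))"
  shows "((\<lambda>c. ereal (a c) * V c) \<longlongrightarrow> ereal l) (at_right 0) \<longleftrightarrow> ((\<lambda>c. a c * real_of_ereal (V c)) \<longlongrightarrow> l) (at_right 0)"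
proof -
  have "\<forall>\<^sub>F c in at_right 0. ereal (a c) * V c = ereal (a c * real_of_ereal (V c))"
    using assms by (intro eventually_at_rightI[of 0 1]) (auto simp flip: times_ereal.simps(1))
  then have "((\<lambda>c. ereal (a c) * V c) \<longlongrightarrow> ereal l) (at_right 0) \<longleftrightarrow> ((\<lambda>c. ereal (a c * real_of_ereal (V c))) \<longlongrightarrow> ereal l) (at_right 0)"
    by (rule tendsto_cong)
  then show ?thesis by simp
qed

lemma truncated_variation_mono_on:
  assumes x: "cadlag x" and c: "c > 0"
  shows "mono_on {0..} (\<lambda>t. real_of_ereal (TV c x 0 t))"
    and "mono_on {0..} (\<lambda>t. real_of_ereal (UTV c x 0 t))"
    and "mono_on {0..} (\<lambda>t. real_of_ereal (DTV c x 0 t))"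
proof -
  show "mono_on {0..} (\<lambda>t. real_of_ereal (TV c x 0 t))"
  proof (rule mono_onI)
    fix s t :: real assume "s \<in> {0..}" "t \<in> {0..}" "s \<le> t"
    then show "real_of_ereal (TV c x 0 s) \<le> real_of_ereal (TV c x 0 t)"
      using TV_superadditive[OF x c, of s t] by simp
  qed
  have *: "mono_on {0..} (\<lambda>t. real_of_ereal (DTV c z 0 t))" if z: "cadlag z" for z
  proof (rule mono_onI)
    fix s t :: real assume st: "s \<in> {0..}" "t \<in> {0..}" "s \<le> t"
    then have "ereal (real_of_ereal (DTV c z 0 s)) \<le> ereal (real_of_ereal (DTV c z 0 t))"
      using DTV_mono[of s t c z] TV_finite(2)[OF z c, of s] TV_finite(2)[OF z c, of t] by simp
    then show "real_of_ereal (DTV c z 0 s) \<le> real_of_ereal (DTV c z 0 t)" by simp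
  qed
  show "mono_on {0..} (\<lambda>t. real_of_ereal (UTV c x 0 t))" "mono_on {0..} (\<lambda>t. real_of_ereal (DTV c x 0 t))"
    using *[OF x] *[OF cadlag_uminus[OF x]] unfolding UTV_eq_DTV_uminus by simp_all
qed

text \<open>For fixed \<open>t\<close>, the functionals TV, twice UTV and twice DTV differ by at
  most \<open>2 * R + c\<close>, where \<open>R\<close> bounds the path on \<open>{0..t}\<close>
  independently of \<open>c\<close>; multiplication by \<open>\<phi> c\<close> removes this
  difference in the limit.\<close>

lemma truncated_variation_conv_iff:
  fixes x \<zeta> \<phi> :: "real \<Rightarrow> real"
  assumes x: "cadlag x" and \<phi>: "\<And>c. c > 0 \<Longrightarrow> \<phi> c \<ge> 0" "(\<phi> \<longlongrightarrow> 0) (at_right 0)"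
  shows "TV_conv \<phi> x \<zeta> \<longleftrightarrow> (\<forall>t\<ge>0. ((\<lambda>c. \<phi> c * real_of_ereal (TV c x 0 t)) \<longlongrightarrow> \<zeta> t) (at_right 0))"
    and "UTV_conv \<phi> x \<zeta> \<longleftrightarrow> TV_conv \<phi> x \<zeta>"
    and "DTV_conv \<phi> x \<zeta> \<longleftrightarrow> TV_conv \<phi> x \<zeta>"
proof -
  show 1: "TV_conv \<phi> x \<zeta> \<longleftrightarrow> (\<forall>t\<ge>0. ((\<lambda>c. \<phi> c * real_of_ereal (TV c x 0 t)) \<longlongrightarrow> \<zeta> t) (at_right 0))"
    unfolding TV_conv_def by (intro all_cong1 imp_cong refl ereal_tendsto_iff_real TV_finite[OF x])
  have comm: "2 * \<phi> c * a = \<phi> c * (2 * a)" for c a by simp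
  have eq: "((\<lambda>c. \<phi> c * A c) \<longlongrightarrow> l) (at_right 0) \<longleftrightarrow> ((\<lambda>c. \<phi> c * B c) \<longlongrightarrow> l) (at_right 0)"
    if "\<And>c. 0 < c \<Longrightarrow> \<bar>A c - B c\<bar> \<le> k + c" for A B k l
    using tendsto_transfer_bounded[OF \<phi>, of A B k l] tendsto_transfer_bounded[OF \<phi>, of B A k l] that
    by (auto simp: abs_minus_commute)
  have U: "((\<lambda>c. ereal (2 * \<phi> c) * UTV c x 0 t) \<longlongrightarrow> ereal (\<zeta> t)) (at_right 0)
      \<longleftrightarrow> ((\<lambda>c. \<phi> c * real_of_ereal (TV c x 0 t)) \<longlongrightarrow> \<zeta> t) (at_right 0)"
    and D: "((\<lambda>c. ereal (2 * \<phi> c) * DTV c x 0 t) \<longlongrightarrow> ereal (\<zeta> t)) (at_right 0)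
      \<longleftrightarrow> ((\<lambda>c. \<phi> c * real_of_ereal (TV c x 0 t)) \<longlongrightarrow> \<zeta> t) (at_right 0)" if t: "0 \<le> t" for t
  proof -
    obtain R where R: "R \<ge> 0" "\<And>u. u \<in> {0..t} \<Longrightarrow> \<bar>x u\<bar> \<le> R" using cadlag_bounded[OF x t] by blast
    have "((\<lambda>c. ereal (2 * \<phi> c) * UTV c x 0 t) \<longlongrightarrow> ereal (\<zeta> t)) (at_right 0)
      \<longleftrightarrow> ((\<lambda>c. \<phi> c * (2 * real_of_ereal (UTV c x 0 t))) \<longlongrightarrow> \<zeta> t) (at_right 0)"
      using ereal_tendsto_iff_real[OF TV_finite(3)[OF x _ t], where a = "\<lambda>c. 2 * \<phi> c" and l = "\<zeta> t"] unfolding comm by simp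
    also have "\<dots> \<longleftrightarrow> ((\<lambda>c. \<phi> c * real_of_ereal (TV c x 0 t)) \<longlongrightarrow> \<zeta> t) (at_right 0)"
      by (rule eq) (rule UTV_near_TV(2)[OF x _ t R(2)])
    finally show "((\<lambda>c. ereal (2 * \<phi> c) * UTV c x 0 t) \<longlongrightarrow> ereal (\<zeta> t)) (at_right 0)
      \<longleftrightarrow> ((\<lambda>c. \<phi> c * real_of_ereal (TV c x 0 t)) \<longlongrightarrow> \<zeta> t) (at_right 0)" .
    have "((\<lambda>c. ereal (2 * \<phi> c) * DTV c x 0 t) \<longlongrightarrow> ereal (\<zeta> t)) (at_right 0)
      \<longleftrightarrow> ((\<lambda>c. \<phi> c * (2 * real_of_ereal (DTV c x 0 t))) \<longlongrightarrow> \<zeta> t) (at_right 0)"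
      using ereal_tendsto_iff_real[OF TV_finite(2)[OF x _ t], where a = "\<lambda>c. 2 * \<phi> c" and l = "\<zeta> t"] unfolding comm by simp
    also have "\<dots> \<longleftrightarrow> ((\<lambda>c. \<phi> c * real_of_ereal (TV c x 0 t)) \<longlongrightarrow> \<zeta> t) (at_right 0)"
      by (rule eq) (rule crossings_near_TV(2)[OF x _ t R(2)])
    finally show "((\<lambda>c. ereal (2 * \<phi> c) * DTV c x 0 t) \<longlongrightarrow> ereal (\<zeta> t)) (at_right 0)
      \<longleftrightarrow> ((\<lambda>c. \<phi> c * real_of_ereal (TV c x 0 t)) \<longlongrightarrow> \<zeta> t) (at_right 0)" .
  qed
  show "UTV_conv \<phi> x \<zeta> \<longleftrightarrow> TV_conv \<phi> x \<zeta>" "DTV_conv \<phi> x \<zeta> \<longleftrightarrow> TV_conv \<phi> x \<zeta>"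
    unfolding 1 UTV_conv_def DTV_conv_def using U D by auto
qed

section \<open>Assembly of the equivalences, limits and uniform limits\<close>

theorem theorem2p2:
  fixes x \<zeta> \<phi> :: "real \<Rightarrow> real"
  assumes "cadlag x"
    and "cadlag \<zeta>"
    and "\<And>c. c > 0 \<Longrightarrow> \<phi> c \<ge> 0"
    and "(\<phi> \<longlongrightarrow> 0) (at_right 0)"
  shows "(TV_conv \<phi> x \<zeta> \<longleftrightarrow> UTV_conv \<phi> x \<zeta>) \<and>
    (TV_conv \<phi> x \<zeta> \<longleftrightarrow> DTV_conv \<phi> x \<zeta>) \<and>
    (TV_conv \<phi> x \<zeta> \<or> UTV_conv \<phi> x \<zeta> \<or> DTV_conv \<phi> x \<zeta> \<longrightarrow>
      (\<forall>t\<ge>0. \<zeta> t \<ge> 0) \<and>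
      mono_on {0..} \<zeta> \<and>
      (\<forall>g :: real \<Rightarrow> real. continuous_on UNIV g \<longrightarrow>
        (\<forall>t\<ge>0.
          ((\<lambda>c. \<phi> c * (LINT y|lborel. real (ncross y c x 0 t) * g y))
             \<longlongrightarrow> LS_integral (\<lambda>s. g (left_lim x s)) \<zeta> t) (at_right 0) \<and>
          ((\<lambda>c. \<phi> c * (LINT y|lborel. 2 * real (ucross y c x 0 t) * g y))
             \<longlongrightarrow> LS_integral (\<lambda>s. g (left_lim x s)) \<zeta> t) (at_right 0) \<and>
          ((\<lambda>c. \<phi> c * (LINT y|lborel. 2 * real (dcross y c x 0 t) * g y))
             \<longlongrightarrow> LS_integral (\<lambda>s. g (left_lim x s)) \<zeta> t) (at_right 0))) \<and>
      (continuous_on {0..} \<zeta> \<longrightarrow>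
        (\<forall>T. compact T \<and> T \<subseteq> {0..} \<longrightarrow>
          uniform_limit T (\<lambda>c t. \<phi> c * real_of_ereal (TV c x 0 t)) \<zeta> (at_right 0) \<and>
          uniform_limit T (\<lambda>c t. 2 * \<phi> c * real_of_ereal (UTV c x 0 t)) \<zeta> (at_right 0) \<and>
          uniform_limit T (\<lambda>c t. 2 * \<phi> c * real_of_ereal (DTV c x 0 t)) \<zeta> (at_right 0) \<and>
          (\<forall>g :: real \<Rightarrow> real. continuous_on UNIV g \<longrightarrow>
            uniform_limit T
              (\<lambda>c t. \<phi> c * (LINT y|lborel. real (ncross y c x 0 t) * g y))
              (\<lambda>t. LS_integral (\<lambda>s. g (left_lim x s)) \<zeta> t) (at_right 0) \<and>
            uniform_limit T
              (\<lambda>c t. \<phi> c * (LINT y|lborel. 2 * real (ucross y c x 0 t) * g y))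
              (\<lambda>t. LS_integral (\<lambda>s. g (left_lim x s)) \<zeta> t) (at_right 0) \<and>
            uniform_limit T
              (\<lambda>c t. \<phi> c * (LINT y|lborel. 2 * real (dcross y c x 0 t) * g y))
              (\<lambda>t. LS_integral (\<lambda>s. g (left_lim x s)) \<zeta> t) (at_right 0)))))"
proof -
  note x = assms(1) and \<zeta> = assms(2) and \<phi> = assms(3,4)
  have ev: "\<forall>\<^sub>F c in at_right (0::real). 0 < c" by (rule eventually_at_right_less)
  note iff = truncated_variation_conv_iff[OF x \<phi>, where \<zeta> = \<zeta>]
  show ?thesis
  proof (intro conjI impI)
    show "TV_conv \<phi> x \<zeta> \<longleftrightarrow> UTV_conv \<phi> x \<zeta>" "TV_conv \<phi> x \<zeta> \<longleftrightarrow> DTV_conv \<phi> x \<zeta>" using iff by auto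
    assume "TV_conv \<phi> x \<zeta> \<or> UTV_conv \<phi> x \<zeta> \<or> DTV_conv \<phi> x \<zeta>"
    then have "TV_conv \<phi> x \<zeta>" using iff by auto
    then have lim: "((\<lambda>c. \<phi> c * real_of_ereal (TV c x 0 t)) \<longlongrightarrow> \<zeta> t) (at_right 0)" if "0 \<le> t" for t
      using iff(1) that by blast
    have mono: "mono_on {0..} \<zeta>"
    proof (rule mono_onI)
      fix s t :: real assume st: "s \<in> {0..}" "t \<in> {0..}" "s \<le> t"
      show "\<zeta> s \<le> \<zeta> t"
      proof (rule tendsto_le[OF _ lim lim])
        show "\<forall>\<^sub>F c in at_right 0. \<phi> c * real_of_ereal (TV c x 0 s) \<le> \<phi> c * real_of_ereal (TV c x 0 t)"
          using ev
        proof eventually_elim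
          case (elim c)
          show ?case
            using mono_onD[OF truncated_variation_mono_on(1)[OF x elim] st] \<phi>(1)[OF elim] by (rule mult_left_mono)
        qed
      qed (use st in auto)
    qed
    \<comment> \<open>On the degenerate interval the truncated variation vanishes, so the limit
      there is \<open>0\<close>; non-negativity of \<open>\<zeta>\<close> then follows from
      monotonicity.\<close>
    have \<zeta>0: "\<zeta> 0 = 0"
    proof (rule tendsto_unique[OF _ lim])
      have "((\<lambda>_. 0) \<longlongrightarrow> (0::real)) (at_right (0::real))" by simp
      then show "((\<lambda>c. \<phi> c * real_of_ereal (TV c x 0 0)) \<longlongrightarrow> 0) (at_right 0)"
        by (rule Lim_transform_eventually) (use ev in \<open>auto elim!: eventually_mono simp: TV_degenerate\<close>)
    qed auto
    show "\<forall>t\<ge>0. 0 \<le> \<zeta> t" using mono_onD[OF mono, of 0] \<zeta>0 by auto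
    show "mono_on {0..} \<zeta>" by (rule mono)
    interpret u: crossing_counts x "\<lambda>c t y. real (ucross y c x 0 t)" 1 by (rule crossing_counts_ucross[OF x])
    interpret d: crossing_counts x "\<lambda>c t y. real (dcross y c x 0 t)" 1 by (rule crossing_counts_dcross[OF x])
    define Ns :: "(real \<Rightarrow> real \<Rightarrow> real \<Rightarrow> real) set" where
      "Ns = {\<lambda>c t y. real (ncross y c x 0 t), \<lambda>c t y. 2 * real (ucross y c x 0 t), \<lambda>c t y. 2 * real (dcross y c x 0 t)}"
    \<comment> \<open>Each of the three counts is a sum of two counts with constant
      \<open>1\<close>: up plus down, up plus up, or down plus down.\<close>
    have counts: "crossing_counts x N 2" if "N \<in> Ns" for N
    proof -
      note cu = u.crossing_counts_axioms and cd = d.crossing_counts_axioms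
      show ?thesis
        using that crossing_counts_add[OF cu cd] crossing_counts_add[OF cu cu] crossing_counts_add[OF cd cd]
        by (auto simp: Ns_def ncross_def)
    qed
    have limN: "((\<lambda>c. \<phi> c * (LINT y|lborel. N c t y)) \<longlongrightarrow> \<zeta> t) (at_right 0)" if N: "N \<in> Ns" and t: "0 \<le> t" for N t
    proof -
      obtain R where R: "R \<ge> 0" "\<And>u. u \<in> {0..t} \<Longrightarrow> \<bar>x u\<bar> \<le> R" using cadlag_bounded[OF x t] by blast
      show ?thesis
      proof (rule tendsto_transfer_bounded[OF \<phi> _ lim[OF t]])
        fix c :: real assume c: "0 < c"
        have "(LINT y|lborel. real (ncross y c x 0 t)) = (LINT y|lborel. real (ucross y c x 0 t)) + (LINT y|lborel. real (dcross y c x 0 t))"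
          using u.N_integrable[OF c t] d.N_integrable[OF c t] by (simp add: ncross_def)
        then show "\<bar>real_of_ereal (TV c x 0 t) - (LINT y|lborel. N c t y)\<bar> \<le> 2 * R + c"
          using N crossings_near_TV(1)[OF x c t R(2)] UTV_near_TV(1)[OF x c t R(2)] by (auto simp: Ns_def)
      qed
    qed
    let ?LS = "\<lambda>g. LS_integral (\<lambda>s. g (left_lim x s)) \<zeta>"
    have conv: "((\<lambda>c. \<phi> c * (LINT y|lborel. N c t y * g y)) \<longlongrightarrow> ?LS g t) (at_right 0)"
      if "N \<in> Ns" "continuous_on UNIV g" "0 \<le> t" for N g t
      using crossing_counts.tendsto_LS_integral[OF counts[OF that(1)] _ \<zeta> mono \<zeta>0 \<phi> limN[OF that(1)] that(2,3)] by simp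
    then show "\<forall>g :: real \<Rightarrow> real. continuous_on UNIV g \<longrightarrow> (\<forall>t\<ge>0.
        ((\<lambda>c. \<phi> c * (LINT y|lborel. real (ncross y c x 0 t) * g y)) \<longlongrightarrow> ?LS g t) (at_right 0) \<and>
        ((\<lambda>c. \<phi> c * (LINT y|lborel. 2 * real (ucross y c x 0 t) * g y)) \<longlongrightarrow> ?LS g t) (at_right 0) \<and>
        ((\<lambda>c. \<phi> c * (LINT y|lborel. 2 * real (dcross y c x 0 t) * g y)) \<longlongrightarrow> ?LS g t) (at_right 0))"
      by (auto simp: Ns_def)
    assume cont: "continuous_on {0..} \<zeta>"
    show "\<forall>T. compact T \<and> T \<subseteq> {0..} \<longrightarrow>
      uniform_limit T (\<lambda>c t. \<phi> c * real_of_ereal (TV c x 0 t)) \<zeta> (at_right 0) \<and>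
      uniform_limit T (\<lambda>c t. 2 * \<phi> c * real_of_ereal (UTV c x 0 t)) \<zeta> (at_right 0) \<and>
      uniform_limit T (\<lambda>c t. 2 * \<phi> c * real_of_ereal (DTV c x 0 t)) \<zeta> (at_right 0) \<and>
      (\<forall>g :: real \<Rightarrow> real. continuous_on UNIV g \<longrightarrow>
        uniform_limit T (\<lambda>c t. \<phi> c * (LINT y|lborel. real (ncross y c x 0 t) * g y)) (?LS g) (at_right 0) \<and>
        uniform_limit T (\<lambda>c t. \<phi> c * (LINT y|lborel. 2 * real (ucross y c x 0 t) * g y)) (?LS g) (at_right 0) \<and>
        uniform_limit T (\<lambda>c t. \<phi> c * (LINT y|lborel. 2 * real (dcross y c x 0 t) * g y)) (?LS g) (at_right 0))"
    proof (intro allI impI, elim conjE)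
      fix T :: "real set" assume "compact T" "T \<subseteq> {0..}"
      then obtain b where T: "T \<subseteq> {0..b}"
        using bounded_real[of T] compact_imp_bounded[of T] by fastforce
      have uN: "uniform_limit T (\<lambda>c t. \<phi> c * (LINT y|lborel. N c t y * g y)) (?LS g) (at_right 0)"
        if "N \<in> Ns" "continuous_on UNIV g" for N g
        using crossing_counts.uniform_limit_LS_integral[OF counts[OF that(1)] _ \<zeta> mono \<zeta>0 cont \<phi> limN[OF that(1)] that(2) T] by simp
      \<comment> \<open>The factor \<open>a\<close> is \<open>1\<close> for TV and \<open>2\<close>
        for UTV and DTV. All three are non-decreasing in \<open>t\<close>, so the squeezing argument
        applies directly.\<close>
      have uV: "uniform_limit T (\<lambda>c t. a * \<phi> c * real_of_ereal (V c t)) \<zeta> (at_right 0)"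
        if V: "\<And>c. 0 < c \<Longrightarrow> mono_on {0..} (\<lambda>t. real_of_ereal (V c t))" and a: "0 \<le> a"
          and fin: "\<And>c t. 0 < c \<Longrightarrow> 0 \<le> t \<Longrightarrow> V c t = ereal (real_of_ereal (V c t))"
          and lim: "\<forall>t\<ge>0. ((\<lambda>c. ereal (a * \<phi> c) * V c t) \<longlongrightarrow> ereal (\<zeta> t)) (at_right 0)" for V a
      proof (rule uniform_limit_of_mono[OF _ _ cont T])
        show "\<forall>\<^sub>F c in at_right 0. mono_on {0..} (\<lambda>t. a * \<phi> c * real_of_ereal (V c t))"
          using ev
        proof eventually_elim
          case (elim c)
          show ?case using V[OF elim] \<phi>(1)[OF elim] a by (auto simp: mono_on_def intro!: mult_left_mono)
        qed
        show "((\<lambda>c. a * \<phi> c * real_of_ereal (V c t)) \<longlongrightarrow> \<zeta> t) (at_right 0)" if "0 \<le> t" for t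
          using lim that ereal_tendsto_iff_real[of "\<lambda>c. V c t" "\<lambda>c. a * \<phi> c" "\<zeta> t"] fin by simp
      qed
      have "TV_conv \<phi> x \<zeta>" "UTV_conv \<phi> x \<zeta>" "DTV_conv \<phi> x \<zeta>" using \<open>TV_conv \<phi> x \<zeta>\<close> iff by auto
      then have "uniform_limit T (\<lambda>c t. \<phi> c * real_of_ereal (TV c x 0 t)) \<zeta> (at_right 0)"
        "uniform_limit T (\<lambda>c t. 2 * \<phi> c * real_of_ereal (UTV c x 0 t)) \<zeta> (at_right 0)"
        "uniform_limit T (\<lambda>c t. 2 * \<phi> c * real_of_ereal (DTV c x 0 t)) \<zeta> (at_right 0)"
        using uV[of "\<lambda>c. TV c x 0" 1] uV[of "\<lambda>c. UTV c x 0" 2] uV[of "\<lambda>c. DTV c x 0" 2]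
          truncated_variation_mono_on[OF x] TV_finite[OF x]
        by (auto simp: TV_conv_def UTV_conv_def DTV_conv_def)
      moreover have "uniform_limit T (\<lambda>c t. \<phi> c * (LINT y|lborel. real (ncross y c x 0 t) * g y)) (?LS g) (at_right 0)"
        "uniform_limit T (\<lambda>c t. \<phi> c * (LINT y|lborel. 2 * real (ucross y c x 0 t) * g y)) (?LS g) (at_right 0)"
        "uniform_limit T (\<lambda>c t. \<phi> c * (LINT y|lborel. 2 * real (dcross y c x 0 t) * g y)) (?LS g) (at_right 0)"
        if g: "continuous_on UNIV g" for g
        using uN[OF _ g, of "\<lambda>c t y. real (ncross y c x 0 t)"] uN[OF _ g, of "\<lambda>c t y. 2 * real (ucross y c x 0 t)"]
          uN[OF _ g, of "\<lambda>c t y. 2 * real (dcross y c x 0 t)"] by (simp_all add: Ns_def)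
      ultimately show "uniform_limit T (\<lambda>c t. \<phi> c * real_of_ereal (TV c x 0 t)) \<zeta> (at_right 0) \<and>
        uniform_limit T (\<lambda>c t. 2 * \<phi> c * real_of_ereal (UTV c x 0 t)) \<zeta> (at_right 0) \<and>
        uniform_limit T (\<lambda>c t. 2 * \<phi> c * real_of_ereal (DTV c x 0 t)) \<zeta> (at_right 0) \<and>
        (\<forall>g :: real \<Rightarrow> real. continuous_on UNIV g \<longrightarrow>
          uniform_limit T (\<lambda>c t. \<phi> c * (LINT y|lborel. real (ncross y c x 0 t) * g y)) (?LS g) (at_right 0) \<and>
          uniform_limit T (\<lambda>c t. \<phi> c * (LINT y|lborel. 2 * real (ucross y c x 0 t) * g y)) (?LS g) (at_right 0) \<and>
          uniform_limit T (\<lambda>c t. \<phi> c * (LINT y|lborel. 2 * real (dcross y c x 0 t) * g y)) (?LS g) (at_right 0))"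
        by blast
    qed
  qed
qed

end
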